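(* Let $\mathcal{C}$ be a quasiminimal class, let $(M,H)$ and $(N,H)$ be $H$-structures associated to $\mathcal{C}$, and let $\vec a\in M$, $\vec a'\in N$ be $H$-independent finite tuples such that $\operatorname{tp}(\vec a,H(\vec a))=\operatorname{tp}(\vec a',H(\vec a'))$. Then $\operatorname{tp}_H(\vec a)=\operatorname{tp}_H(\vec a')$. Furthermore, for any $b\in M$ there is $b'\in N$ such that $\operatorname{tp}_H(\vec a b)=\operatorname{tp}_H(\vec a'b')$.
   Context: **Quasiminimal classes.** Let $\mathcal{L}$ be a countable language. $\operatorname{tp}$ denotes the quantifier-free $\mathcal{L}$-type of a (possibly infinite, enumerated) tuple; in the structures below it is identified with the $\mathcal{L}_{\omega_1\omega}$-type. An $\mathcal{L}$-structure $M$ equipped with a pregeometry $\operatorname{cl}$ is a *quasiminimal pregeometry structure* if: (QM1) if $\operatorname{tp}(a,\vec b)=\operatorname{tp}(a',\vec b')$ then $a\in\operatorname{cl}(\vec b)$ iff $a'\in\operatorname{cl}(\vec b')$; (QM2) $M$ is infinite-dimensional with respect to $\operatorname{cl}$; (QM3) $\operatorname{cl}(A)$ is countable for every finite $A\subseteq M$; (QM4) if $A,A'\subseteq M$ are countable closed subsets enumerated so that $\operatorname{tp}(A)=\operatorname{tp}(A')$, $a\in M\setminus A$ and $a'\in M\setminus A'$, then $\operatorname{tp}(A,a)=\operatorname{tp}(A',a')$; (QM5) if $A,A'\subseteq M$ are countable closed subsets or empty, enumerated so that $\operatorname{tp}(A)=\operatorname{tp}(A')$, $\vec b,\vec b'$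 are finite tuples with $\operatorname{tp}(A,\vec b)=\operatorname{tp}(A',\vec b')$ and $a\in\operatorname{cl}(A,\vec b)$, then there is $a'\in M$ with $\operatorname{tp}(A,\vec b,a)=\operatorname{tp}(A',\vec b',a')$. It is a *weakly quasiminimal pregeometry structure* if all axioms except possibly QM2 hold. An embedding $\theta:M_1\to M_2$ of such structures is *closed* if $\theta(\operatorname{cl}_{M_1}(A))=\operatorname{cl}_{M_2}(\theta(A))$ for all $A\subseteq M_1$; $M_1\preceq M_2$ means that the inclusion is a closed embedding. A *quasiminimal class* $\mathcal{C}$ is the smallest class of $\mathcal{L}$-structures containing a given quasiminimal pregeometry structure and closed under isomorphism, closed substructures, and unions of chains of closed embeddings; each member is a weakly quasiminimal pregeometry structure with its pregeometry $\operatorname{cl}$. $\dim(\vec a/B)$ is the dimension of $\vec a$ in the localized pregeometry $\operatorname{cl}_B(X)=\operatorname{cl}(X\cup B)$. **$H$-structures.** Let $H$ be a new unary predicate, $\mathcal{L}_H=\mathcal{L}\cup\{H\}$, $M\in\mathcal{C}$. $(M,H)$ is *dense-codense* if for all $b_1,\dots,b_n\in M$: (density) some $a\in H(M)$ realizes the unique generic type over $\operatorname{cl}(b_1,\dots,b_n)$, i.e. $a\notin\operatorname{cl}(b_1,\dots,b_n)$; (codensity) there is $a\in M$ with $a\notin\operatorname{cl}(\{b_1,\dots,b_n\}\cup H(M))$. It is an *$H$-structure* if in addition any distinct elements of $H(M)$ are $\operatorname{cl}$-independent. $\operatorname{tp}_H(\vec a)$ denotes the $(\mathcal{L}_H)_{\omega_1\omega}$-type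 of $\vec a$ in $(M,H)$. $H(\vec a)$ denotes the subtuple of entries of $\vec a$ lying in $H$. The tuple $\vec a$ is *$H$-independent* if $\dim(\vec a/H(\vec a))=\dim(\vec a/H(M))$. The equality $\operatorname{tp}(\vec a,H(\vec a))=\operatorname{tp}(\vec a',H(\vec a'))$ means that $\operatorname{tp}(\vec a)=\operatorname{tp}(\vec a')$ and the entries of $\vec a$ in $H$ occur at the same coordinates as the entries of $\vec a'$ in $H$. *)

theory Defs
  imports Complex_Main "HOL-Library.Countable_Set"
begin

section \<open>Languages, structures, infinitary formulas\<close>

text \<open>Constants are nullary function symbols. Only the values of the arity functions on
  \<open>funs\<close> and \<open>rels\<close> matter.\<close>

record ('f, 'r) language =
  funs :: "'f set"
  rels :: "'r set"
  farity :: "'f \<Rightarrow> nat"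
  rarity :: "'r \<Rightarrow> nat"

definition countable_language :: "('f, 'r) language \<Rightarrow> bool" where
  "countable_language L \<longleftrightarrow> countable (funs L) \<and> countable (rels L)"

text \<open>Interpretations are arbitrary away from the symbols of the language and from argument lists
  of the right length over the universe; nothing below depends on those values.\<close>

record ('f, 'r, 'a) struct =
  univ :: "'a set"
  fint :: "'f \<Rightarrow> 'a list \<Rightarrow> 'a"
  rint :: "'r \<Rightarrow> 'a list \<Rightarrow> bool"

definition is_struct :: "('f, 'r) language \<Rightarrow> ('f, 'r, 'a, 'z) struct_scheme \<Rightarrow> bool" where
  "is_struct L M \<longleftrightarrow>
    (\<forall>f \<in> funs L. \<forall>xs. length xs = farity L f \<and> set xs \<subseteq> univ M \<longrightarrow> fint M f xs \<in> univ M)"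

definition embedding ::
  "('f, 'r) language \<Rightarrow> ('a \<Rightarrow> 'b) \<Rightarrow> ('f, 'r, 'a, 'y) struct_scheme \<Rightarrow> ('f, 'r, 'b, 'z) struct_scheme
    \<Rightarrow> bool" where
  "embedding L \<theta> M N \<longleftrightarrow>
    inj_on \<theta> (univ M) \<and> \<theta> ` univ M \<subseteq> univ N \<and>
    (\<forall>f \<in> funs L. \<forall>xs. length xs = farity L f \<and> set xs \<subseteq> univ M \<longrightarrow>
      \<theta> (fint M f xs) = fint N f (map \<theta> xs)) \<and>
    (\<forall>r \<in> rels L. \<forall>xs. length xs = rarity L r \<and> set xs \<subseteq> univ M \<longrightarrow>
      rint M r xs = rint N r (map \<theta> xs))"

datatype ('f, 'v) trm = Var 'v | App 'f "('f, 'v) trm list"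

text \<open>\<open>Conj\<close> is the countable conjunction. It subsumes \<open>And\<close>, which is kept so that the finitary
  quantifier-free formulas are a syntactic fragment.\<close>

datatype ('f, 'r, 'v) fm =
    Eq "('f, 'v) trm" "('f, 'v) trm"
  | Rel 'r "('f, 'v) trm list"
  | Neg "('f, 'r, 'v) fm"
  | And "('f, 'r, 'v) fm" "('f, 'r, 'v) fm"
  | Conj "nat \<Rightarrow> ('f, 'r, 'v) fm"
  | Ex 'v "('f, 'r, 'v) fm"

fun wf_trm :: "('f, 'r) language \<Rightarrow> ('f, 'v) trm \<Rightarrow> bool" where
  "wf_trm L (Var v) = True"
| "wf_trm L (App f ts) = (f \<in> funs L \<and> length ts = farity L f \<and> (\<forall>t \<in> set ts. wf_trm L t))"

fun fv_trm :: "('f, 'v) trm \<Rightarrow> 'v set" where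
  "fv_trm (Var v) = {v}"
| "fv_trm (App f ts) = (\<Union>t \<in> set ts. fv_trm t)"

primrec wf_fm :: "('f, 'r) language \<Rightarrow> ('f, 'r, 'v) fm \<Rightarrow> bool" where
  "wf_fm L (Eq s t) = (wf_trm L s \<and> wf_trm L t)"
| "wf_fm L (Rel r ts) = (r \<in> rels L \<and> length ts = rarity L r \<and> (\<forall>t \<in> set ts. wf_trm L t))"
| "wf_fm L (Neg \<phi>) = wf_fm L \<phi>"
| "wf_fm L (And \<phi> \<psi>) = (wf_fm L \<phi> \<and> wf_fm L \<psi>)"
| "wf_fm L (Conj \<Phi>) = (\<forall>n. wf_fm L (\<Phi> n))"
| "wf_fm L (Ex v \<phi>) = wf_fm L \<phi>"

primrec fv_fm :: "('f, 'r, 'v) fm \<Rightarrow> 'v set" where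
  "fv_fm (Eq s t) = fv_trm s \<union> fv_trm t"
| "fv_fm (Rel r ts) = (\<Union>t \<in> set ts. fv_trm t)"
| "fv_fm (Neg \<phi>) = fv_fm \<phi>"
| "fv_fm (And \<phi> \<psi>) = fv_fm \<phi> \<union> fv_fm \<psi>"
| "fv_fm (Conj \<Phi>) = (\<Union>n. fv_fm (\<Phi> n))"
| "fv_fm (Ex v \<phi>) = fv_fm \<phi> - {v}"

primrec qfree :: "('f, 'r, 'v) fm \<Rightarrow> bool" where
  "qfree (Eq s t) = True"
| "qfree (Rel r ts) = True"
| "qfree (Neg \<phi>) = qfree \<phi>"
| "qfree (And \<phi> \<psi>) = (qfree \<phi> \<and> qfree \<psi>)"
| "qfree (Conj \<Phi>) = False"
| "qfree (Ex v \<phi>) = False"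

fun trm_val :: "('f, 'r, 'a, 'z) struct_scheme \<Rightarrow> ('v \<Rightarrow> 'a) \<Rightarrow> ('f, 'v) trm \<Rightarrow> 'a" where
  "trm_val M e (Var v) = e v"
| "trm_val M e (App f ts) = fint M f (map (trm_val M e) ts)"

primrec sat :: "('f, 'r, 'a, 'z) struct_scheme \<Rightarrow> ('f, 'r, 'v) fm \<Rightarrow> ('v \<Rightarrow> 'a) \<Rightarrow> bool" where
  "sat M (Eq s t) e = (trm_val M e s = trm_val M e t)"
| "sat M (Rel r ts) e = rint M r (map (trm_val M e) ts)"
| "sat M (Neg \<phi>) e = (\<not> sat M \<phi> e)"
| "sat M (And \<phi> \<psi>) e = (sat M \<phi> e \<and> sat M \<psi> e)"
| "sat M (Conj \<Phi>) e = (\<forall>n. sat M (\<Phi> n) e)"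
| "sat M (Ex v \<phi>) e = (\<exists>x \<in> univ M. sat M \<phi> (e(v := x)))"

section \<open>Types\<close>

text \<open>A tuple is a family \<open>e\<close> on an index set \<open>I\<close>, and the indices are the variables; the values of
  \<open>e\<close> outside \<open>I\<close> are irrelevant. Equality of types forces equality of the index sets
  (look at the formulas \<open>v = v\<close>), so for lists it forces equal lengths.\<close>

definition qf_type ::
  "('f, 'r) language \<Rightarrow> ('f, 'r, 'a, 'z) struct_scheme \<Rightarrow> 'v set \<Rightarrow> ('v \<Rightarrow> 'a) \<Rightarrow> ('f, 'r, 'v) fm set"
where
  "qf_type L M I e = {\<phi>. wf_fm L \<phi> \<and> qfree \<phi> \<and> fv_fm \<phi> \<subseteq> I \<and> sat M \<phi> e}"

definition tp ::
  "('f, 'r) language \<Rightarrow> ('f, 'r, 'a, 'z) struct_scheme \<Rightarrow> 'a list \<Rightarrow> ('f, 'r, nat) fm set" where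
  "tp L M xs = qf_type L M {..<length xs} (nth xs)"

text \<open>The type of the concatenation of the tuple \<open>\<alpha>\<close> on \<open>I\<close>, enumerating a countable set
  \<open>\<alpha> ` I\<close>, with the finite tuple \<open>bs\<close>.\<close>

definition tp_ext ::
  "('f, 'r) language \<Rightarrow> ('f, 'r, 'a, 'z) struct_scheme \<Rightarrow> nat set \<Rightarrow> (nat \<Rightarrow> 'a) \<Rightarrow> 'a list
    \<Rightarrow> ('f, 'r, nat + nat) fm set" where
  "tp_ext L M I \<alpha> bs = qf_type L M (I <+> {..<length bs}) (case_sum \<alpha> (nth bs))"

text \<open>Countably many variables suffice here: every subformula of a formula with finitely many free
  variables again has only finitely many.\<close>

definition inf_type ::
  "('f, 'r) language \<Rightarrow> ('f, 'r, 'a, 'z) struct_scheme \<Rightarrow> 'a list \<Rightarrow> ('f, 'r, nat) fm set" where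
  "inf_type L M xs = {\<phi>. wf_fm L \<phi> \<and> fv_fm \<phi> \<subseteq> {..<length xs} \<and> sat M \<phi> (nth xs)}"

section \<open>Pregeometries\<close>

definition pregeometry :: "'a set \<Rightarrow> ('a set \<Rightarrow> 'a set) \<Rightarrow> bool" where
  "pregeometry S c \<longleftrightarrow>
    (\<forall>A \<subseteq> S. A \<subseteq> c A \<and> c A \<subseteq> S \<and> c (c A) = c A) \<and>
    (\<forall>A B. A \<subseteq> B \<and> B \<subseteq> S \<longrightarrow> c A \<subseteq> c B) \<and>
    (\<forall>A \<subseteq> S. \<forall>x \<in> c A. \<exists>F \<subseteq> A. finite F \<and> x \<in> c F) \<and>
    (\<forall>A \<subseteq> S. \<forall>x \<in> S. \<forall>y \<in> S. x \<in> c (insert y A) \<and> x \<notin> c A \<longrightarrow> y \<in> c (insert x A))"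

definition localize :: "('a set \<Rightarrow> 'a set) \<Rightarrow> 'a set \<Rightarrow> 'a set \<Rightarrow> 'a set" where
  "localize c B X = c (X \<union> B)"

definition indep :: "('a set \<Rightarrow> 'a set) \<Rightarrow> 'a set \<Rightarrow> bool" where
  "indep c X \<longleftrightarrow> (\<forall>x \<in> X. x \<notin> c (X - {x}))"

definition basis_of :: "('a set \<Rightarrow> 'a set) \<Rightarrow> 'a set \<Rightarrow> 'a set \<Rightarrow> bool" where
  "basis_of c X B \<longleftrightarrow> B \<subseteq> X \<and> indep c B \<and> X \<subseteq> c B"

text \<open>The dimension of a finite tuple over \<open>B\<close>: the common size of all its bases.\<close>

definition dim_over :: "('a set \<Rightarrow> 'a set) \<Rightarrow> 'a list \<Rightarrow> 'a set \<Rightarrow> nat" where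
  "dim_over c xs B = (THE n. \<exists>D. basis_of (localize c B) (set xs) D \<and> card D = n)"

section \<open>Quasiminimal pregeometry structures and quasiminimal classes\<close>

record ('f, 'r, 'a) pgstruct = "('f, 'r, 'a) struct" +
  cl :: "'a set \<Rightarrow> 'a set"

definition is_pgstruct :: "('f, 'r) language \<Rightarrow> ('f, 'r, 'a) pgstruct \<Rightarrow> bool" where
  "is_pgstruct L M \<longleftrightarrow> is_struct L M \<and> pregeometry (univ M) (cl M)"

definition QM1 :: "('f, 'r) language \<Rightarrow> ('f, 'r, 'a) pgstruct \<Rightarrow> bool" where
  "QM1 L M \<longleftrightarrow>
    (\<forall>a bs a' bs'. set (a # bs) \<subseteq> univ M \<and> set (a' # bs') \<subseteq> univ M \<and>
      tp L M (a # bs) = tp L M (a' # bs') \<longrightarrow>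
      (a \<in> cl M (set bs) \<longleftrightarrow> a' \<in> cl M (set bs')))"

definition QM2 :: "('f, 'r, 'a) pgstruct \<Rightarrow> bool" where
  "QM2 M \<longleftrightarrow> (\<exists>B. basis_of (cl M) (univ M) B \<and> infinite B)"

definition QM3 :: "('f, 'r, 'a) pgstruct \<Rightarrow> bool" where
  "QM3 M \<longleftrightarrow> (\<forall>A \<subseteq> univ M. finite A \<longrightarrow> countable (cl M A))"

definition closed_in :: "('f, 'r, 'a) pgstruct \<Rightarrow> 'a set \<Rightarrow> bool" where
  "closed_in M A \<longleftrightarrow> A \<subseteq> univ M \<and> cl M A = A"

text \<open>In the next two axioms \<open>\<alpha> ` I\<close> and \<open>\<alpha>' ` I\<close> are the countable sets \<open>A\<close> and \<open>A'\<close> with their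
  enumerations; letting \<open>I\<close> be a set of naturals covers finite and empty sets as well.\<close>

definition QM4 :: "('f, 'r) language \<Rightarrow> ('f, 'r, 'a) pgstruct \<Rightarrow> bool" where
  "QM4 L M \<longleftrightarrow>
    (\<forall>(I :: nat set) \<alpha> \<alpha>' a a'.
      closed_in M (\<alpha> ` I) \<and> closed_in M (\<alpha>' ` I) \<and> qf_type L M I \<alpha> = qf_type L M I \<alpha>' \<and>
      a \<in> univ M - \<alpha> ` I \<and> a' \<in> univ M - \<alpha>' ` I \<longrightarrow>
      tp_ext L M I \<alpha> [a] = tp_ext L M I \<alpha>' [a'])"

definition QM5 :: "('f, 'r) language \<Rightarrow> ('f, 'r, 'a) pgstruct \<Rightarrow> bool" where
  "QM5 L M \<longleftrightarrow>
    (\<forall>(I :: nat set) \<alpha> \<alpha>' bs bs' a.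
      (closed_in M (\<alpha> ` I) \<or> \<alpha> ` I = {}) \<and> (closed_in M (\<alpha>' ` I) \<or> \<alpha>' ` I = {}) \<and>
      qf_type L M I \<alpha> = qf_type L M I \<alpha>' \<and>
      set bs \<subseteq> univ M \<and> set bs' \<subseteq> univ M \<and>
      tp_ext L M I \<alpha> bs = tp_ext L M I \<alpha>' bs' \<and>
      a \<in> cl M (\<alpha> ` I \<union> set bs) \<longrightarrow>
      (\<exists>a' \<in> univ M. tp_ext L M I \<alpha> (bs @ [a]) = tp_ext L M I \<alpha>' (bs' @ [a'])))"

definition weakly_quasiminimal :: "('f, 'r) language \<Rightarrow> ('f, 'r, 'a) pgstruct \<Rightarrow> bool" where
  "weakly_quasiminimal L M \<longleftrightarrow> is_pgstruct L M \<and> QM1 L M \<and> QM3 M \<and> QM4 L M \<and> QM5 L M"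

definition quasiminimal :: "('f, 'r) language \<Rightarrow> ('f, 'r, 'a) pgstruct \<Rightarrow> bool" where
  "quasiminimal L M \<longleftrightarrow> weakly_quasiminimal L M \<and> QM2 M"

definition closed_embedding ::
  "('f, 'r) language \<Rightarrow> ('a \<Rightarrow> 'b) \<Rightarrow> ('f, 'r, 'a) pgstruct \<Rightarrow> ('f, 'r, 'b) pgstruct \<Rightarrow> bool" where
  "closed_embedding L \<theta> M N \<longleftrightarrow>
    is_pgstruct L M \<and> is_pgstruct L N \<and> embedding L \<theta> M N \<and>
    (\<forall>A \<subseteq> univ M. \<theta> ` cl M A = cl N (\<theta> ` A))"

definition closed_sub :: "('f, 'r) language \<Rightarrow> ('f, 'r, 'a) pgstruct \<Rightarrow> ('f, 'r, 'a) pgstruct \<Rightarrow> bool"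
where
  "closed_sub L M N \<longleftrightarrow> univ M \<subseteq> univ N \<and> closed_embedding L id M N"

text \<open>The members carry their pregeometries. In the rule for unions, \<open>N\<close> is determined on its
  universe by the chain: any finitely many elements of \<open>N\<close> lie in one member of the chain, which
  fixes the interpretations and the closures of finite sets, and \<open>cl N\<close> has finite character.
  All structures of the class live on one type; this loses nothing because that type is arbitrary.\<close>

inductive_set generated_class ::
  "('f, 'r) language \<Rightarrow> ('f, 'r, 'a) pgstruct \<Rightarrow> ('f, 'r, 'a) pgstruct set"
  for L :: "('f, 'r) language" and M0 :: "('f, 'r, 'a) pgstruct"
where
  base: "M0 \<in> generated_class L M0"
| iso: "M \<in> generated_class L M0 \<Longrightarrow> closed_embedding L \<theta> M N \<Longrightarrow> \<theta> ` univ M = univ N \<Longrightarrow>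
    N \<in> generated_class L M0"
| sub: "M \<in> generated_class L M0 \<Longrightarrow> closed_sub L N M \<Longrightarrow> N \<in> generated_class L M0"
| chain_union: "K \<noteq> {} \<Longrightarrow> (\<And>M. M \<in> K \<Longrightarrow> M \<in> generated_class L M0) \<Longrightarrow>
    (\<And>M M'. M \<in> K \<Longrightarrow> M' \<in> K \<Longrightarrow> closed_sub L M M' \<or> closed_sub L M' M) \<Longrightarrow>
    univ N = (\<Union>M \<in> K. univ M) \<Longrightarrow> (\<And>M. M \<in> K \<Longrightarrow> closed_sub L M N) \<Longrightarrow>
    N \<in> generated_class L M0"

definition quasiminimal_class :: "('f, 'r) language \<Rightarrow> ('f, 'r, 'a) pgstruct set \<Rightarrow> bool" where
  "quasiminimal_class L C \<longleftrightarrow> (\<exists>M0. quasiminimal L M0 \<and> C = generated_class L M0)"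

section \<open>H-structures\<close>

text \<open>The new unary predicate is the relation symbol \<open>None\<close>.\<close>

definition lang_H :: "('f, 'r) language \<Rightarrow> ('f, 'r option) language" where
  "lang_H L = \<lparr>funs = funs L, rels = insert None (Some ` rels L), farity = farity L,
    rarity = case_option 1 (rarity L)\<rparr>"

definition expand_H :: "('f, 'r, 'a) pgstruct \<Rightarrow> 'a set \<Rightarrow> ('f, 'r option, 'a) struct" where
  "expand_H M H = \<lparr>univ = univ M, fint = fint M,
    rint = case_option (\<lambda>xs. hd xs \<in> H) (rint M)\<rparr>"

definition tp_H ::
  "('f, 'r) language \<Rightarrow> ('f, 'r, 'a) pgstruct \<Rightarrow> 'a set \<Rightarrow> 'a list \<Rightarrow> ('f, 'r option, nat) fm set" where
  "tp_H L M H xs = inf_type (lang_H L) (expand_H M H) xs"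

definition dense_codense :: "('f, 'r, 'a) pgstruct \<Rightarrow> 'a set \<Rightarrow> bool" where
  "dense_codense M H \<longleftrightarrow> H \<subseteq> univ M \<and>
    (\<forall>bs. set bs \<subseteq> univ M \<longrightarrow>
      (\<exists>a \<in> H. a \<notin> cl M (set bs)) \<and> (\<exists>a \<in> univ M. a \<notin> cl M (set bs \<union> H)))"

definition H_structure :: "('f, 'r, 'a) pgstruct set \<Rightarrow> ('f, 'r, 'a) pgstruct \<Rightarrow> 'a set \<Rightarrow> bool" where
  "H_structure C M H \<longleftrightarrow> M \<in> C \<and> dense_codense M H \<and>
    (\<forall>hs. distinct hs \<and> set hs \<subseteq> H \<longrightarrow> indep (cl M) (set hs))"

definition H_independent :: "('f, 'r, 'a) pgstruct \<Rightarrow> 'a set \<Rightarrow> 'a list \<Rightarrow> bool" where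
  "H_independent M H xs \<longleftrightarrow> dim_over (cl M) xs (set xs \<inter> H) = dim_over (cl M) xs H"

definition same_tp_with_H ::
  "('f, 'r) language \<Rightarrow> ('f, 'r, 'a) pgstruct \<Rightarrow> 'a set \<Rightarrow> 'a list
    \<Rightarrow> ('f, 'r, 'a) pgstruct \<Rightarrow> 'a set \<Rightarrow> 'a list \<Rightarrow> bool" where
  "same_tp_with_H L M H xs N H' ys \<longleftrightarrow>
    tp L M xs = tp L N ys \<and> (\<forall>i < length xs. xs ! i \<in> H \<longleftrightarrow> ys ! i \<in> H')"

end

theory Submission
  imports Defs
begin

text \<open>The proof is a back-and-forth argument between \<open>M\<close> and \<open>N\<close>, carried out with finite relations
  between the two universes instead of tuples.

  An \<open>H\<close>-independent tuple \<open>a\<close> has a basis \<open>D\<close> over \<open>H\<close> that is also a basis over \<open>H(a)\<close>. As \<open>H\<close> is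
  independent, \<open>D\<close> is disjoint from \<open>H\<close> and \<open>D \<union> H\<close> is independent, while \<open>a\<close> lies in the closure of \<open>D \<union> H(a)\<close>
  (\<open>H_indep_setI\<close>). In this form the condition is easily seen to survive the extensions below, and
  it shows that the closure of \<open>a\<close> meets \<open>H\<close> only in \<open>H(a)\<close>.

  Let a finite partial isomorphism be given that respects \<open>H\<close> and has \<open>H\<close>-independent domain and
  range, and let \<open>b \<in> M\<close>. If \<open>b\<close> is in the closure of the domain, QM5 gives an image, and the
  predicate \<open>H\<close> takes care of itself. If \<open>b \<in> H\<close> is outside that closure, density gives a
  generic image in \<open>H\<close>; if \<open>b\<close> is outside the closure of the domain together with \<open>H\<close>, codensity
  gives a generic image outside \<open>H\<close>; in both cases generic elements realize the same type. In the
  remaining case \<open>b\<close> depends on the domain and finitely many elements of \<open>H\<close>, and these are added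
  first (\<open>H_partial_iso_extend\<close>). A back-and-forth system preserves all infinitary formulas
  (\<open>sat_H_partial_iso\<close>), which gives both claims.

  The axioms QM1, QM4 and QM5 speak of a single structure, but are needed between \<open>M\<close> and \<open>N\<close>.
  This is possible because the closure of any finite subset of a member of the class embeds, preserving
  types and closures, into the generating structure (\<open>generated_class_locally_embeds\<close>), where the
  axioms hold. Uniqueness of the generic type over a finite tuple follows from QM4 once a back and
  forth with QM5 has extended a finite partial isomorphism to the closures
  (\<open>partial_iso_extends_to_closures\<close>).\<close>

section \<open>Partial isomorphisms\<close>

text \<open>A relation serves as a partial map whose injectivity and single-valuedness are consequences
  (\<open>partial_iso_eq_iff\<close>). Pairs may be listed in any order and with repetitions, so equalities of
  types of tuples and of enumerated countable sets all become statements about the underlying set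
  of pairs, which is what makes reindexing harmless.\<close>

definition partial_iso ::
  "('f, 'r) language \<Rightarrow> ('f, 'r, 'a, 'y) struct_scheme \<Rightarrow> ('f, 'r, 'b, 'z) struct_scheme
    \<Rightarrow> ('a \<times> 'b) set \<Rightarrow> bool" where
  "partial_iso L M N p \<longleftrightarrow>
    (\<forall>(\<phi> :: ('f, 'r, nat) fm) e e'. wf_fm L \<phi> \<and> qfree \<phi> \<and> (\<forall>v \<in> fv_fm \<phi>. (e v, e' v) \<in> p)
      \<longrightarrow> sat M \<phi> e = sat N \<phi> e')"

lemma partial_isoD:
  assumes "partial_iso L M N p" "wf_fm L (\<phi> :: ('f, 'r, nat) fm)" "qfree \<phi>"
    "\<And>v. v \<in> fv_fm \<phi> \<Longrightarrow> (e v, e' v) \<in> p"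
  shows "sat M \<phi> e \<longleftrightarrow> sat N \<phi> e'"
  using assms unfolding partial_iso_def by blast

lemma finite_fv_trm: "finite (fv_trm t)"
  by (induction t) auto

lemma finite_fv_qfree: "qfree \<phi> \<Longrightarrow> finite (fv_fm \<phi>)"
  by (induction \<phi>) (auto simp: finite_fv_trm)

lemma trm_val_cong: "(\<And>v. v \<in> fv_trm t \<Longrightarrow> e v = e' v) \<Longrightarrow> trm_val M e t = trm_val M e' t"
proof (induction t)
  case (App f ts)
  then have eq: "map (trm_val M e) ts = map (trm_val M e') ts"
    by (auto intro!: map_cong)
  show ?case by (simp only: trm_val.simps eq)
qed simp

lemma sat_cong_qfree:
  "qfree \<phi> \<Longrightarrow> (\<And>v. v \<in> fv_fm \<phi> \<Longrightarrow> e v = e' v) \<Longrightarrow> sat M \<phi> e = sat M \<phi> e'"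
proof (induction \<phi>)
  case (Eq s t)
  then show ?case using trm_val_cong[of s e e' M] trm_val_cong[of t e e' M] by simp
next
  case (Rel r ts)
  then have eq: "map (trm_val M e) ts = map (trm_val M e') ts"
    by (intro map_cong trm_val_cong) auto
  show ?case by (simp only: sat.simps eq)
qed auto

lemma trm_val_rename: "trm_val M e (map_trm (\<lambda>x. x) f t) = trm_val M (\<lambda>x. e (f x)) t"
proof (induction t)
  case (App g ts)
  then have eq: "map (trm_val M e) (map (map_trm (\<lambda>x. x) f) ts) = map (trm_val M (\<lambda>x. e (f x))) ts"
    by (auto intro!: map_cong)
  show ?case by (simp only: trm.map trm_val.simps eq)
qed simp

lemma fv_trm_rename: "fv_trm (map_trm (\<lambda>x. x) f t) = f ` fv_trm t"
  by (induction t) auto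

lemma wf_trm_rename: "wf_trm L (map_trm (\<lambda>x. x) f t) = wf_trm L t"
  by (induction t) auto

lemma sat_rename:
  "qfree \<phi> \<Longrightarrow> sat M (map_fm (\<lambda>x. x) (\<lambda>x. x) f \<phi>) e = sat M \<phi> (\<lambda>x. e (f x))"
proof (induction \<phi>)
  case (Rel r ts)
  have eq: "map (trm_val M e) (map (map_trm (\<lambda>x. x) f) ts) = map (trm_val M (\<lambda>x. e (f x))) ts"
    by (auto simp: trm_val_rename)
  show ?case by (simp only: fm.map sat.simps eq)
qed (auto simp: trm_val_rename)

lemma fv_rename: "qfree \<phi> \<Longrightarrow> fv_fm (map_fm (\<lambda>x. x) (\<lambda>x. x) f \<phi>) = f ` fv_fm \<phi>"
  by (induction \<phi>) (auto simp: fv_trm_rename)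

lemma wf_rename: "qfree \<phi> \<Longrightarrow> wf_fm L (map_fm (\<lambda>x. x) (\<lambda>x. x) f \<phi>) = wf_fm L \<phi>"
  by (induction \<phi>) (auto simp: wf_trm_rename)

lemma qfree_rename: "qfree \<phi> \<Longrightarrow> qfree (map_fm (\<lambda>x. x) (\<lambda>x. x) f \<phi>)"
  by (induction \<phi>) auto

text \<open>The choice of the variables is immaterial as long as they embed into the natural numbers;
  this covers the variables in \<^typ>\<open>nat + nat\<close> that \<^const>\<open>tp_ext\<close> uses.\<close>

lemma partial_iso_sat_countable_vars:
  fixes \<phi> :: "('f, 'r, 'v :: countable) fm"
  assumes "partial_iso L M N p" "wf_fm L \<phi>" "qfree \<phi>"
    "\<And>v. v \<in> fv_fm \<phi> \<Longrightarrow> (e v, e' v) \<in> p"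
  shows "sat M \<phi> e \<longleftrightarrow> sat N \<phi> e'"
proof -
  let ?\<psi> = "map_fm (\<lambda>x. x) (\<lambda>x. x) to_nat \<phi>"
  have "sat M ?\<psi> (\<lambda>n. e (from_nat n)) \<longleftrightarrow> sat N ?\<psi> (\<lambda>n. e' (from_nat n))"
    using assms by (intro partial_isoD[OF assms(1)])
      (auto simp: wf_rename qfree_rename fv_rename)
  then show ?thesis using assms by (simp add: sat_rename)
qed

text \<open>From left to right, a formula evaluated at pairs in the range of \<open>(e, e')\<close> is turned into one
  evaluated at \<open>e\<close> and \<open>e'\<close> themselves by renaming each variable to an index of its pair.\<close>

lemma qf_type_eq_iff:
  fixes L :: "('f, 'r) language" and e :: "'v :: countable \<Rightarrow> 'a" and e' :: "'v \<Rightarrow> 'b"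
  shows "qf_type L M I e = qf_type L N I e' \<longleftrightarrow> partial_iso L M N ((\<lambda>i. (e i, e' i)) ` I)"
proof
  assume eq: "qf_type L M I e = qf_type L N I e'"
  show "partial_iso L M N ((\<lambda>i. (e i, e' i)) ` I)"
    unfolding partial_iso_def
  proof (intro allI impI, elim conjE)
    fix \<phi> :: "('f, 'r, nat) fm" and d d'
    assume wf: "wf_fm L \<phi>" and q: "qfree \<phi>"
      and d: "\<forall>v \<in> fv_fm \<phi>. (d v, d' v) \<in> (\<lambda>i. (e i, e' i)) ` I"
    then have "\<forall>v \<in> fv_fm \<phi>. \<exists>i. i \<in> I \<and> d v = e i \<and> d' v = e' i"
      by auto
    then obtain f where f: "\<forall>v \<in> fv_fm \<phi>. f v \<in> I \<and> d v = e (f v) \<and> d' v = e' (f v)"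
      by metis
    let ?\<psi> = "map_fm (\<lambda>x. x) (\<lambda>x. x) f \<phi>"
    have "?\<psi> \<in> qf_type L M I e \<longleftrightarrow> ?\<psi> \<in> qf_type L N I e'"
      using eq by simp
    then have "sat M ?\<psi> e \<longleftrightarrow> sat N ?\<psi> e'"
      using wf q f by (auto simp: qf_type_def wf_rename qfree_rename fv_rename)
    then have "sat M \<phi> (\<lambda>x. e (f x)) \<longleftrightarrow> sat N \<phi> (\<lambda>x. e' (f x))"
      using q by (simp add: sat_rename)
    moreover have "sat M \<phi> d = sat M \<phi> (\<lambda>x. e (f x))"
      using f by (intro sat_cong_qfree[OF q]) auto
    moreover have "sat N \<phi> d' = sat N \<phi> (\<lambda>x. e' (f x))"
      using f by (intro sat_cong_qfree[OF q]) auto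
    ultimately show "sat M \<phi> d = sat N \<phi> d'" by simp
  qed
next
  assume p: "partial_iso L M N ((\<lambda>i. (e i, e' i)) ` I)"
  have "sat M \<phi> e = sat N \<phi> e'" if "wf_fm L \<phi>" "qfree \<phi>" "fv_fm \<phi> \<subseteq> I" for \<phi>
    using that by (intro partial_iso_sat_countable_vars[OF p]) auto
  then show "qf_type L M I e = qf_type L N I e'"
    by (auto simp: qf_type_def)
qed

text \<open>The formula \<open>v = v\<close> belongs to a type exactly if \<open>v\<close> is one of its indices.\<close>

lemma tp_eq_length:
  assumes "tp L M xs = tp L N ys"
  shows "length xs = length ys"
proof -
  have "(Eq (Var n) (Var n) \<in> tp L M xs) = (n < length xs)" for n
    by (auto simp: tp_def qf_type_def)
  moreover have "(Eq (Var n) (Var n) \<in> tp L N ys) = (n < length ys)" for n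
    by (auto simp: tp_def qf_type_def)
  ultimately have "n < length xs \<longleftrightarrow> n < length ys" for n using assms by simp
  from this[of "length xs"] this[of "length ys"] show ?thesis by simp
qed

lemma tp_eq_iff:
  "tp L M xs = tp L N ys \<longleftrightarrow> length xs = length ys \<and> partial_iso L M N (set (zip xs ys))"
proof (cases "length xs = length ys")
  case True
  have "set (zip xs ys) = (\<lambda>i. (xs ! i, ys ! i)) ` {..<length xs}"
    using True by (auto simp: set_zip)
  then show ?thesis using True by (simp add: tp_def qf_type_eq_iff)
next
  case False
  then show ?thesis using tp_eq_length[of L M xs N ys] by auto
qed

lemma tp_ext_eq_iff:
  assumes "length bs = length bs'"
  shows "tp_ext L M I \<alpha> bs = tp_ext L N I \<alpha>' bs' \<longleftrightarrow>
    partial_iso L M N ((\<lambda>i. (\<alpha> i, \<alpha>' i)) ` I \<union> set (zip bs bs'))"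
proof -
  have "(\<lambda>i. (case_sum \<alpha> ((!) bs) i, case_sum \<alpha>' ((!) bs') i)) ` (I <+> {..<length bs}) =
      (\<lambda>i. (\<alpha> i, \<alpha>' i)) ` I \<union> set (zip bs bs')"
    using assms by (auto simp: set_zip Plus_def image_Un image_image)
  then show ?thesis using assms by (simp add: tp_ext_def qf_type_eq_iff)
qed

lemma partial_iso_mono: "partial_iso L M N p \<Longrightarrow> q \<subseteq> p \<Longrightarrow> partial_iso L M N q"
  unfolding partial_iso_def by (meson subsetD)

lemma partial_iso_converse: "partial_iso L M N p \<Longrightarrow> partial_iso L N M (p\<inverse>)"
  by (simp add: partial_iso_def) metis

lemma partial_iso_comp:
  assumes "partial_iso L M N p" "partial_iso L N K q"
  shows "partial_iso L M K (p O q)"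
  unfolding partial_iso_def
proof (intro allI impI, elim conjE)
  fix \<phi> :: "('a, 'b, nat) fm" and e e'
  assume wf: "wf_fm L \<phi>" "qfree \<phi>" and pq: "\<forall>v \<in> fv_fm \<phi>. (e v, e' v) \<in> p O q"
  then have "\<forall>v \<in> fv_fm \<phi>. \<exists>y. (e v, y) \<in> p \<and> (y, e' v) \<in> q" by blast
  then obtain d where "\<forall>v \<in> fv_fm \<phi>. (e v, d v) \<in> p \<and> (d v, e' v) \<in> q" by metis
  then show "sat M \<phi> e = sat K \<phi> e'"
    using partial_isoD[OF assms(1) wf, of e d] partial_isoD[OF assms(2) wf, of d e'] by blast
qed

lemma partial_iso_eq_iff:
  assumes "partial_iso L M N p" "(x, y) \<in> p" "(x', y') \<in> p"
  shows "x = x' \<longleftrightarrow> y = y'"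
  using partial_isoD[OF assms(1), of "Eq (Var 0) (Var 1)"
      "\<lambda>n. if n = 0 then x else x'" "\<lambda>n. if n = 0 then y else y'"] assms(2,3)
  by auto

text \<open>A formula mentions finitely many pairs, and these already lie in one member of the chain.\<close>

lemma partial_iso_UN:
  fixes p :: "nat \<Rightarrow> ('a \<times> 'b) set"
  assumes "\<And>n. partial_iso L M N (p n)" "\<And>n. p n \<subseteq> p (Suc n)"
  shows "partial_iso L M N (\<Union>n. p n)"
  unfolding partial_iso_def
proof (intro allI impI, elim conjE)
  fix \<phi> :: "('c, 'd, nat) fm" and e e'
  assume wf: "wf_fm L \<phi>" "qfree \<phi>" and "\<forall>v \<in> fv_fm \<phi>. (e v, e' v) \<in> (\<Union>n. p n)"
  then obtain k where k: "\<forall>v \<in> fv_fm \<phi>. (e v, e' v) \<in> p (k v)"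
    unfolding UN_iff by metis
  have fin: "finite (k ` fv_fm \<phi>)" using wf(2) by (simp add: finite_fv_qfree)
  have "(e v, e' v) \<in> p (Max (k ` fv_fm \<phi>))" if "v \<in> fv_fm \<phi>" for v
  proof -
    have "k v \<le> Max (k ` fv_fm \<phi>)" using fin that by simp
    then have "p (k v) \<subseteq> p (Max (k ` fv_fm \<phi>))" using lift_Suc_mono_le[of p] assms(2) by blast
    then show ?thesis using k that by blast
  qed
  then show "sat M \<phi> e = sat N \<phi> e'" using partial_isoD[OF assms(1) wf] by blast
qed

lemma trm_val_in_univ:
  assumes "is_struct L M"
  shows "wf_trm L t \<Longrightarrow> (\<And>v. v \<in> fv_trm t \<Longrightarrow> e v \<in> univ M) \<Longrightarrow> trm_val M e t \<in> univ M"
proof (induction t)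
  case (App f ts)
  then have "set (map (trm_val M e) ts) \<subseteq> univ M" by auto
  then show ?case using assms App.prems(1) by (auto simp: is_struct_def)
qed auto

lemma trm_val_embedding:
  assumes "is_struct L M" "embedding L \<theta> M N"
  shows "wf_trm L t \<Longrightarrow> (\<And>v. v \<in> fv_trm t \<Longrightarrow> e v \<in> univ M \<and> e' v = \<theta> (e v)) \<Longrightarrow>
    trm_val N e' t = \<theta> (trm_val M e t)"
proof (induction t)
  case (App f ts)
  have eq: "map (trm_val N e') ts = map \<theta> (map (trm_val M e) ts)"
    using App by auto
  have "set (map (trm_val M e) ts) \<subseteq> univ M"
    using App.prems trm_val_in_univ[OF assms(1)] by fastforce
  then have "\<theta> (fint M f (map (trm_val M e) ts)) = fint N f (map \<theta> (map (trm_val M e) ts))"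
    using assms(2) App.prems(1) unfolding embedding_def by (metis length_map wf_trm.simps(2))
  then show ?case by (simp only: trm_val.simps eq)
qed auto

lemma partial_iso_embedding:
  fixes M :: "('f, 'r, 'a, 'y) struct_scheme"
  assumes "is_struct L M" "embedding L \<theta> M N"
  shows "partial_iso L M N ((\<lambda>x. (x, \<theta> x)) ` univ M)"
proof -
  have "sat M \<phi> e = sat N \<phi> e'"
    if "wf_fm L \<phi>" "qfree \<phi>" "\<forall>v \<in> fv_fm \<phi>. e v \<in> univ M \<and> e' v = \<theta> (e v)"
    for \<phi> :: "('f, 'r, nat) fm" and e e'
    using that
  proof (induction \<phi>)
    case (Eq s t)
    then have "trm_val M e s \<in> univ M" "trm_val M e t \<in> univ M"
      by (auto intro!: trm_val_in_univ[OF assms(1)])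
    moreover have "trm_val N e' s = \<theta> (trm_val M e s)" "trm_val N e' t = \<theta> (trm_val M e t)"
      using Eq by (auto intro!: trm_val_embedding[OF assms])
    ultimately show ?case using assms(2) by (auto simp: embedding_def inj_on_eq_iff)
  next
    case (Rel r ts)
    then have eq: "map (trm_val N e') ts = map \<theta> (map (trm_val M e) ts)"
      by (auto intro!: trm_val_embedding[OF assms])
    have "set (map (trm_val M e) ts) \<subseteq> univ M"
      using Rel by (auto intro!: trm_val_in_univ[OF assms(1)])
    then have "rint M r (map (trm_val M e) ts) = rint N r (map \<theta> (map (trm_val M e) ts))"
      using assms(2) Rel.prems(1) unfolding embedding_def by (metis length_map wf_fm.simps(2))
    then show ?case by (simp only: sat.simps eq)
  qed auto
  then show ?thesis unfolding partial_iso_def by (auto simp: image_iff)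
qed

section \<open>Pregeometries\<close>

context
  fixes S :: "'a set" and c :: "'a set \<Rightarrow> 'a set"
  assumes pg: "pregeometry S c"
begin

lemma cl_extensive: "A \<subseteq> S \<Longrightarrow> A \<subseteq> c A"
  using pg by (auto simp: pregeometry_def)

lemma cl_subset: "A \<subseteq> S \<Longrightarrow> c A \<subseteq> S"
  using pg by (auto simp: pregeometry_def)

lemma cl_idem: "A \<subseteq> S \<Longrightarrow> c (c A) = c A"
  using pg by (auto simp: pregeometry_def)

lemma cl_mono: "A \<subseteq> B \<Longrightarrow> B \<subseteq> S \<Longrightarrow> c A \<subseteq> c B"
  using pg unfolding pregeometry_def by meson

lemma cl_finitary: "A \<subseteq> S \<Longrightarrow> x \<in> c A \<Longrightarrow> \<exists>F \<subseteq> A. finite F \<and> x \<in> c F"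
  using pg unfolding pregeometry_def by meson

lemma cl_exchange:
  "A \<subseteq> S \<Longrightarrow> x \<in> S \<Longrightarrow> y \<in> S \<Longrightarrow> x \<in> c (insert y A) \<Longrightarrow> x \<notin> c A \<Longrightarrow> y \<in> c (insert x A)"
  using pg unfolding pregeometry_def by meson

lemma cl_least: "A \<subseteq> c B \<Longrightarrow> B \<subseteq> S \<Longrightarrow> c A \<subseteq> c B"
  using cl_mono[of A "c B"] cl_subset cl_idem by auto

lemma indep_insert:
  assumes "indep c X" "X \<subseteq> S" "b \<in> S" "b \<notin> c X"
  shows "indep c (insert b X)"
  unfolding indep_def
proof
  fix x assume x: "x \<in> insert b X"
  have bX: "b \<notin> X" using assms cl_extensive by blast
  show "x \<notin> c (insert b X - {x})"
  proof (cases "x = b")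
    case True
    then show ?thesis using bX assms(4) by simp
  next
    case False
    then have "x \<in> X" using x by simp
    show ?thesis
    proof
      assume "x \<in> c (insert b X - {x})"
      then have "x \<in> c (insert b (X - {x}))" using False by (simp add: insert_Diff_if)
      moreover have "x \<notin> c (X - {x})" using assms(1) \<open>x \<in> X\<close> by (simp add: indep_def)
      ultimately have "b \<in> c (insert x (X - {x}))"
        using assms(2,3) \<open>x \<in> X\<close> cl_exchange[of "X - {x}" x b] by blast
      then show False using \<open>x \<in> X\<close> assms(4) by (simp add: insert_absorb)
    qed
  qed
qed

lemma indep_subset:
  assumes "indep c X" "Y \<subseteq> X" "X \<subseteq> S"
  shows "indep c Y"
  unfolding indep_def
proof
  fix x assume "x \<in> Y"
  moreover have "c (Y - {x}) \<subseteq> c (X - {x})" using assms by (intro cl_mono) auto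
  ultimately show "x \<notin> c (Y - {x})" using assms by (auto simp: indep_def)
qed

text \<open>Steinitz exchange: an \<open>x \<in> I - G\<close> can be replaced by some \<open>g \<in> G\<close> outside the closure of
  \<open>I - {x}\<close>, which exists because otherwise \<open>x\<close> would depend on \<open>I - {x}\<close>. Each replacement brings
  \<open>I\<close> closer to a subset of \<open>G\<close>.\<close>

lemma card_indep_le:
  assumes "finite I" "finite G" "indep c I" "I \<subseteq> c G" "G \<subseteq> S"
  shows "card I \<le> card G"
  using assms(1,3,4)
proof (induction "card (I - G)" arbitrary: I rule: less_induct)
  case less
  show ?case
  proof (cases "I \<subseteq> G")
    case True
    then show ?thesis using assms(2) by (simp add: card_mono)
  next
    case False
    then obtain x where x: "x \<in> I" "x \<notin> G" by blast
    have IS: "I \<subseteq> S" using less.prems assms(5) cl_subset by blast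
    have "\<not> G \<subseteq> c (I - {x})"
    proof
      assume "G \<subseteq> c (I - {x})"
      then have "c G \<subseteq> c (I - {x})" using IS by (intro cl_least) auto
      then show False using x less.prems by (auto simp: indep_def)
    qed
    then obtain g where g: "g \<in> G" "g \<notin> c (I - {x})" by blast
    let ?J = "insert g (I - {x})"
    have gI: "g \<notin> I - {x}" using g cl_extensive[of "I - {x}"] IS by blast
    have "card (?J - G) < card (I - G)"
      using x g less.prems(1) by (intro psubset_card_mono) auto
    moreover have "indep c ?J"
      using g IS assms(5) by (intro indep_insert indep_subset[OF less.prems(2)]) auto
    moreover have "?J \<subseteq> c G" using g less.prems cl_extensive[OF assms(5)] by auto
    ultimately have "card ?J \<le> card G" using less.hyps less.prems(1) by simp
    moreover have "card ?J = card I" using gI x less.prems(1)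
      by (metis card_insert_disjoint card_Suc_Diff1 finite_Diff)
    ultimately show ?thesis by simp
  qed
qed

lemma indep_extends_to_basis:
  assumes "finite X" "X \<subseteq> S" "indep c I" "I \<subseteq> X"
  shows "\<exists>D. I \<subseteq> D \<and> basis_of c X D"
  using assms(3,4)
proof (induction "card (X - I)" arbitrary: I rule: less_induct)
  case less
  show ?case
  proof (cases "X \<subseteq> c I")
    case True
    then show ?thesis using less.prems by (auto simp: basis_of_def)
  next
    case False
    then obtain x where x: "x \<in> X" "x \<notin> c I" by blast
    then have "x \<notin> I" using cl_extensive[of I] less.prems assms(2) by blast
    then have "card (X - insert x I) < card (X - I)"
      using x assms(1) by (intro psubset_card_mono) auto
    moreover have "indep c (insert x I)"
      using x less.prems assms(2) by (intro indep_insert) auto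
    ultimately show ?thesis using less.hyps[of "insert x I"] x less.prems by auto
  qed
qed

lemma basis_card_unique:
  assumes "finite X" "X \<subseteq> S" "basis_of c X D" "basis_of c X E"
  shows "card D = card E"
proof -
  have *: "D \<subseteq> X" "E \<subseteq> X" "X \<subseteq> c D" "X \<subseteq> c E" "indep c D" "indep c E"
    using assms by (simp_all add: basis_of_def)
  then have "finite D" "finite E" "D \<subseteq> S" "E \<subseteq> S" "D \<subseteq> c E" "E \<subseteq> c D"
    using assms(1,2) finite_subset by blast+
  with * show ?thesis by (intro antisym card_indep_le)
qed

lemma pregeometry_localize:
  assumes B: "B \<subseteq> S"
  shows "pregeometry S (localize c B)"
  unfolding pregeometry_def localize_def
proof (intro conjI allI impI ballI)
  fix A assume A: "A \<subseteq> S"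
  then have AB: "A \<union> B \<subseteq> S" using B by simp
  show "A \<subseteq> c (A \<union> B)" "c (A \<union> B) \<subseteq> S" using cl_extensive[OF AB] cl_subset[OF AB] by auto
  have "c (A \<union> B) \<union> B = c (A \<union> B)" using cl_extensive[OF AB] by auto
  then show "c (c (A \<union> B) \<union> B) = c (A \<union> B)" using cl_idem[OF AB] by simp
next
  fix A A' assume "A \<subseteq> A' \<and> A' \<subseteq> S"
  then show "c (A \<union> B) \<subseteq> c (A' \<union> B)" using B by (intro cl_mono) auto
next
  fix A x assume A: "A \<subseteq> S" and "x \<in> c (A \<union> B)"
  then obtain F where F: "F \<subseteq> A \<union> B" "finite F" "x \<in> c F" using cl_finitary[of "A \<union> B" x] B by auto
  have "c F \<subseteq> c ((F \<inter> A) \<union> B)" using F A B by (intro cl_mono) auto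
  then show "\<exists>F \<subseteq> A. finite F \<and> x \<in> c (F \<union> B)" using F by (intro exI[of _ "F \<inter> A"]) auto
next
  fix A x y
  assume "A \<subseteq> S" "x \<in> S" "y \<in> S" "x \<in> c (insert y A \<union> B) \<and> x \<notin> c (A \<union> B)"
  then show "y \<in> c (insert x A \<union> B)" using cl_exchange[of "A \<union> B" x y] B by simp
qed

text \<open>Transitivity of independence: the elements of \<open>D\<close> are added to \<open>B\<close> one at a time.\<close>

lemma indep_Un_localize:
  assumes "finite D" "D \<subseteq> S" "B \<subseteq> S" "indep c B" "indep (localize c B) D"
  shows "D \<inter> B = {}" "indep c (D \<union> B)"
proof -
  have out: "x \<notin> c (D - {x} \<union> B)" if "x \<in> D" for x
    using that assms(5) by (auto simp: indep_def localize_def)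
  show "D \<inter> B = {}"
  proof (intro equals0I, elim IntE)
    fix x assume x: "x \<in> D" "x \<in> B"
    have "D - {x} \<union> B \<subseteq> c (D - {x} \<union> B)" using assms by (intro cl_extensive) auto
    then show False using out[OF x(1)] x(2) by auto
  qed
  have "indep c (E \<union> B)" if "E \<subseteq> D" for E
    using finite_subset[OF that assms(1)] that
  proof (induction E)
    case (insert x E)
    have "c (E \<union> B) \<subseteq> c (D - {x} \<union> B)" using insert assms by (intro cl_mono) auto
    then have "x \<notin> c (E \<union> B)" using out insert by auto
    then show ?case using insert assms indep_insert[of "E \<union> B" x] by auto
  qed (simp add: assms(4))
  then show "indep c (D \<union> B)" by blast
qed

end

lemma dim_over_eq_card:
  assumes "pregeometry S c" "B \<subseteq> S" "set xs \<subseteq> S" "basis_of (localize c B) (set xs) D"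
  shows "dim_over c xs B = card D"
proof -
  have uniq: "card E = card D" if "basis_of (localize c B) (set xs) E" for E
    using basis_card_unique[OF pregeometry_localize[OF assms(1,2)] _ assms(3) that assms(4)] by simp
  show ?thesis
    unfolding dim_over_def
  proof (rule the_equality)
    show "\<exists>E. basis_of (localize c B) (set xs) E \<and> card E = card D" using assms(4) by blast
  qed (use uniq in blast)
qed

text \<open>The form of \<open>H\<close>-independence used below, free of dimensions: \<open>D\<close> is a basis of \<open>X\<close> over \<open>H\<close>
  that generates \<open>X\<close> already over \<open>X \<inter> H\<close>.\<close>

definition H_indep_set :: "('a set \<Rightarrow> 'a set) \<Rightarrow> 'a set \<Rightarrow> 'a set \<Rightarrow> bool" where
  "H_indep_set c H X \<longleftrightarrow>
    (\<exists>D \<subseteq> X. D \<inter> H = {} \<and> indep c (D \<union> H) \<and> X \<subseteq> c (D \<union> (X \<inter> H)))"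

text \<open>A basis \<open>D\<close> of the tuple over \<open>H\<close> is independent over the smaller set \<open>H(xs)\<close> as well, so it
  extends to a basis there. Equality of the two dimensions leaves no room for further elements.\<close>

lemma H_indep_setI:
  assumes pg: "pregeometry S c" and sub: "set xs \<subseteq> S" "H \<subseteq> S" and H: "indep c H"
    and dim: "dim_over c xs (set xs \<inter> H) = dim_over c xs H"
  shows "H_indep_set c H (set xs)"
proof -
  let ?X = "set xs" and ?B = "set xs \<inter> H"
  note pgH = pregeometry_localize[OF pg sub(2)]
  have BS: "?B \<subseteq> S" using sub by auto
  note pgB = pregeometry_localize[OF pg BS]
  obtain D where D: "basis_of (localize c H) ?X D"
    using indep_extends_to_basis[OF pgH, of ?X "{}"] sub by (auto simp: indep_def)
  then have DX: "D \<subseteq> ?X" and Dind: "indep (localize c H) D" by (auto simp: basis_of_def)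
  have "indep (localize c ?B) D"
    unfolding indep_def localize_def
  proof
    fix x assume "x \<in> D"
    moreover have "c (D - {x} \<union> ?B) \<subseteq> c (D - {x} \<union> H)"
      using DX sub by (intro cl_mono[OF pg]) auto
    ultimately show "x \<notin> c (D - {x} \<union> ?B)" using Dind by (auto simp: indep_def localize_def)
  qed
  then obtain E where E: "D \<subseteq> E" "basis_of (localize c ?B) ?X E"
    using indep_extends_to_basis[OF pgB, of ?X D] sub DX by auto
  have "card E = card D"
    using dim dim_over_eq_card[OF pg BS sub(1) E(2)] dim_over_eq_card[OF pg sub(2,1) D] by simp
  moreover have "finite E" using E(2) finite_subset[of E ?X] by (simp add: basis_of_def)
  ultimately have "E = D" using E(1) by (metis card_subset_eq)
  then have "?X \<subseteq> c (D \<union> ?B)" using E(2) by (simp add: basis_of_def localize_def)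
  moreover have "D \<inter> H = {}" "indep c (D \<union> H)"
    using indep_Un_localize[OF pg _ _ sub(2) H Dind] DX sub finite_subset[OF DX] by auto
  ultimately show ?thesis using DX unfolding H_indep_set_def by blast
qed

context
  fixes S :: "'a set" and c :: "'a set \<Rightarrow> 'a set" and H X :: "'a set"
  assumes pg: "pregeometry S c" and sub: "X \<subseteq> S" "H \<subseteq> S" and HX: "H_indep_set c H X"
begin

text \<open>An element of \<open>H\<close> outside \<open>X\<close> cannot depend on \<open>X\<close>, since \<open>X\<close> is generated by a part of the
  independent set \<open>D \<union> H\<close> that omits it.\<close>

lemma H_indep_set_cl_inter_H:
  assumes "b \<in> c X" "b \<in> H"
  shows "b \<in> X"
proof (rule ccontr)
  assume b: "b \<notin> X"
  obtain D where D: "D \<subseteq> X" "indep c (D \<union> H)" "X \<subseteq> c (D \<union> (X \<inter> H))"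
    using HX by (auto simp: H_indep_set_def)
  have "c X \<subseteq> c (D \<union> (X \<inter> H))" using D sub by (intro cl_least[OF pg]) auto
  also have "\<dots> \<subseteq> c (D \<union> H - {b})" using D sub b by (intro cl_mono[OF pg]) auto
  finally have "c X \<subseteq> c (D \<union> H - {b})" .
  then show False using assms D(2) by (auto simp: indep_def)
qed

text \<open>In the first two of the following extensions the witness \<open>D\<close> stays the same; in the third, the
  new element joins it.\<close>

lemma H_indep_set_insert_cl:
  assumes "b \<in> c X"
  shows "H_indep_set c H (insert b X)"
proof -
  obtain D where D: "D \<subseteq> X" "D \<inter> H = {}" "indep c (D \<union> H)" "X \<subseteq> c (D \<union> (X \<inter> H))"
    using HX by (auto simp: H_indep_set_def)
  have "c X \<subseteq> c (D \<union> (X \<inter> H))" using D sub by (intro cl_least[OF pg]) auto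
  moreover have "insert b X \<inter> H = X \<inter> H" using H_indep_set_cl_inter_H assms by auto
  ultimately show ?thesis unfolding H_indep_set_def using D assms by (intro exI[of _ D]) auto
qed

lemma H_indep_set_insert_H:
  assumes "b \<in> H"
  shows "H_indep_set c H (insert b X)"
proof -
  obtain D where D: "D \<subseteq> X" "D \<inter> H = {}" "indep c (D \<union> H)" "X \<subseteq> c (D \<union> (X \<inter> H))"
    using HX by (auto simp: H_indep_set_def)
  let ?Y = "D \<union> (insert b X \<inter> H)"
  have "?Y \<subseteq> S" using D sub by auto
  then have "c (D \<union> (X \<inter> H)) \<subseteq> c ?Y" "?Y \<subseteq> c ?Y"
    by (intro cl_mono[OF pg] cl_extensive[OF pg]; auto)+
  then show ?thesis unfolding H_indep_set_def using D assms by (intro exI[of _ D]) auto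
qed

lemma H_indep_set_insert_generic:
  assumes "b \<in> S" "b \<notin> c (X \<union> H)"
  shows "H_indep_set c H (insert b X)"
proof -
  obtain D where D: "D \<subseteq> X" "D \<inter> H = {}" "indep c (D \<union> H)" "X \<subseteq> c (D \<union> (X \<inter> H))"
    using HX by (auto simp: H_indep_set_def)
  have bH: "b \<notin> H" using assms cl_extensive[OF pg, of "X \<union> H"] sub by auto
  have "c (D \<union> H) \<subseteq> c (X \<union> H)" using D sub by (intro cl_mono[OF pg]) auto
  then have "indep c (insert b (D \<union> H))"
    using D sub assms by (intro indep_insert[OF pg]) auto
  moreover have "insert b D \<union> (X \<inter> H) \<subseteq> S" using D sub assms by auto
  then have "c (D \<union> (X \<inter> H)) \<subseteq> c (insert b D \<union> (X \<inter> H))"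
    "insert b D \<union> (X \<inter> H) \<subseteq> c (insert b D \<union> (X \<inter> H))"
    by (intro cl_mono[OF pg] cl_extensive[OF pg]; blast)+
  ultimately show ?thesis unfolding H_indep_set_def using D bH
    by (intro exI[of _ "insert b D"]) auto
qed

end

section \<open>Members of a quasiminimal class\<close>

text \<open>The closure of \<open>A\<close> embeds into \<open>M0\<close> by \<open>\<theta>\<close> as a closed set. Preservation of types
  takes the place of an embedding of structures, because the closure is a set of elements and is
  not presented as a substructure.\<close>

definition locally_embeds ::
  "('f, 'r) language \<Rightarrow> ('f, 'r, 'a) pgstruct \<Rightarrow> ('f, 'r, 'a) pgstruct \<Rightarrow> 'a set
    \<Rightarrow> ('a \<Rightarrow> 'a) \<Rightarrow> bool" where
  "locally_embeds L M M0 A \<theta> \<longleftrightarrow>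
    \<theta> ` cl M A \<subseteq> univ M0 \<and> partial_iso L M M0 ((\<lambda>x. (x, \<theta> x)) ` cl M A) \<and>
    (\<forall>B \<subseteq> cl M A. \<theta> ` cl M B = cl M0 (\<theta> ` B))"

lemma is_pgstruct_generated_class:
  assumes "M \<in> generated_class L M0" "is_pgstruct L M0"
  shows "is_pgstruct L M"
  using assms
proof (induction rule: generated_class.induct)
  case (chain_union K N)
  then show ?case by (auto simp: closed_sub_def closed_embedding_def)
qed (auto simp: closed_sub_def closed_embedding_def)

lemma closed_subD:
  assumes "closed_sub L N M"
  shows "univ N \<subseteq> univ M" "is_pgstruct L N" "is_pgstruct L M"
    "A \<subseteq> univ N \<Longrightarrow> cl N A = cl M A" "partial_iso L N M ((\<lambda>x. (x, x)) ` univ N)"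
proof -
  have emb: "closed_embedding L id N M" and "univ N \<subseteq> univ M"
    using assms by (simp_all add: closed_sub_def)
  then show "univ N \<subseteq> univ M" "is_pgstruct L N" "is_pgstruct L M" "A \<subseteq> univ N \<Longrightarrow> cl N A = cl M A"
    by (simp_all add: closed_embedding_def)
  show "partial_iso L N M ((\<lambda>x. (x, x)) ` univ N)"
    using partial_iso_embedding[of L N id M] emb by (simp add: closed_embedding_def is_pgstruct_def)
qed

text \<open>Both structures assign the same types to tuples in \<open>N\<close> and the same closures to subsets
  of \<open>N\<close>.\<close>

lemma locally_embeds_closed_sub:
  assumes sub: "closed_sub L N M" and A: "A \<subseteq> univ N"
  shows "locally_embeds L N M0 A \<theta> \<longleftrightarrow> locally_embeds L M M0 A \<theta>"
proof -
  have cl_eq: "cl N A = cl M A" using closed_subD(4)[OF sub A] .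
  have AN: "cl N A \<subseteq> univ N"
    using cl_subset[of "univ N" "cl N" A] A closed_subD(2)[OF sub] by (simp add: is_pgstruct_def)
  let ?I = "(\<lambda>x. (x, x)) ` univ N" and ?G = "(\<lambda>x. (x, \<theta> x)) ` cl N A"
  have I: "partial_iso L N M ?I" using closed_subD(5)[OF sub] .
  have sub_comp: "?G \<subseteq> ?I O ?G" "?G \<subseteq> ?I\<inverse> O ?G" using AN by auto
  have "partial_iso L N M0 ?G \<longleftrightarrow> partial_iso L M M0 ?G"
  proof
    show "partial_iso L N M0 ?G" if "partial_iso L M M0 ?G"
      using partial_iso_mono[OF partial_iso_comp[OF I that] sub_comp(1)] .
    show "partial_iso L M M0 ?G" if "partial_iso L N M0 ?G"
      using partial_iso_mono[OF partial_iso_comp[OF partial_iso_converse[OF I] that] sub_comp(2)] .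
  qed
  moreover have "cl N B = cl M B" if "B \<subseteq> cl N A" for B
    using closed_subD(4)[OF sub] that AN by auto
  ultimately show ?thesis unfolding locally_embeds_def cl_eq by simp
qed

lemma locally_embeds_iso:
  assumes emb: "closed_embedding L \<sigma> M N" and onto: "\<sigma> ` univ M = univ N"
    and B: "B \<subseteq> univ M" and loc: "locally_embeds L M M0 B \<theta>"
  shows "locally_embeds L N M0 (\<sigma> ` B) (\<theta> \<circ> inv_into (univ M) \<sigma>)"
proof -
  let ?i = "inv_into (univ M) \<sigma>"
  have pgM: "is_struct L M" "pregeometry (univ M) (cl M)" and \<sigma>: "embedding L \<sigma> M N"
    and cl: "\<And>A. A \<subseteq> univ M \<Longrightarrow> \<sigma> ` cl M A = cl N (\<sigma> ` A)"
    using emb by (auto simp: closed_embedding_def is_pgstruct_def)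
  have i: "?i (\<sigma> x) = x" if "x \<in> univ M" for x
    using \<sigma> that by (simp add: embedding_def)
  have i_image: "?i ` \<sigma> ` A = A" if "A \<subseteq> univ M" for A
    using i that by (force simp: image_iff)
  have BM: "cl M B \<subseteq> univ M" using cl_subset[OF pgM(2) B] .
  have clN: "cl N (\<sigma> ` B) = \<sigma> ` cl M B" using cl[OF B] by simp
  have "partial_iso L N M0 (((\<lambda>x. (x, \<sigma> x)) ` univ M)\<inverse> O (\<lambda>x. (x, \<theta> x)) ` cl M B)"
    using loc partial_iso_embedding[OF pgM(1) \<sigma>]
    by (intro partial_iso_comp[OF partial_iso_converse]) (auto simp: locally_embeds_def)
  then have "partial_iso L N M0 ((\<lambda>x. (x, (\<theta> \<circ> ?i) x)) ` \<sigma> ` cl M B)"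
  proof (rule partial_iso_mono)
    have "(\<sigma> x, \<theta> x) \<in> ((\<lambda>x. (x, \<sigma> x)) ` univ M)\<inverse> O (\<lambda>x. (x, \<theta> x)) ` cl M B"
      if "x \<in> cl M B" for x
      using that BM by (intro relcompI[of _ x]) auto
    then show "(\<lambda>x. (x, (\<theta> \<circ> ?i) x)) ` \<sigma> ` cl M B
        \<subseteq> ((\<lambda>x. (x, \<sigma> x)) ` univ M)\<inverse> O (\<lambda>x. (x, \<theta> x)) ` cl M B"
      using BM i by (auto simp del: relcomp.simps)
  qed
  moreover have "(\<theta> \<circ> ?i) ` \<sigma> ` cl M B \<subseteq> univ M0"
    using loc i_image[OF BM] unfolding locally_embeds_def by (metis image_comp)
  moreover have "(\<theta> \<circ> ?i) ` cl N C = cl M0 ((\<theta> \<circ> ?i) ` C)" if C: "C \<subseteq> \<sigma> ` cl M B" for C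
  proof -
    obtain D where D: "D \<subseteq> cl M B" "C = \<sigma> ` D" using C by (meson subset_imageE)
    have "D \<subseteq> univ M" "cl M D \<subseteq> univ M" using D BM cl_subset[OF pgM(2)] by auto
    then have "?i ` cl N C = cl M D" "?i ` C = D"
      using D(2) cl[of D] i_image[of D] i_image[of "cl M D"] by simp_all
    then have "(\<theta> \<circ> ?i) ` cl N C = \<theta> ` cl M D" "(\<theta> \<circ> ?i) ` C = \<theta> ` D"
      by (metis image_comp)+
    then show ?thesis using loc D by (simp add: locally_embeds_def)
  qed
  ultimately show ?thesis unfolding locally_embeds_def clN by blast
qed

text \<open>Finiteness of \<open>A\<close> is what lets the induction pass through unions of chains: \<open>A\<close> lies in one
  member of the chain, and its closure is computed there. Infinite sets may be spread over the
  whole chain.\<close>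

lemma generated_class_locally_embeds:
  assumes "M \<in> generated_class L M0" "is_pgstruct L M0" "finite A" "A \<subseteq> univ M"
  shows "\<exists>\<theta>. locally_embeds L M M0 A \<theta>"
  using assms(1,3,4)
proof (induction arbitrary: A rule: generated_class.induct)
  case base
  then have "cl M0 A \<subseteq> univ M0"
    using assms(2) cl_subset[of "univ M0" "cl M0" A] by (simp add: is_pgstruct_def)
  moreover have "partial_iso L M0 M0 ((\<lambda>x. (x, x)) ` cl M0 A)"
    unfolding partial_iso_def by (auto simp: image_iff intro!: sat_cong_qfree)
  ultimately have "locally_embeds L M0 M0 A (\<lambda>x. x)" by (simp add: locally_embeds_def)
  then show ?case by blast
next
  case (iso M \<sigma> N)
  then obtain B where B: "B \<subseteq> univ M" "finite B" "A = \<sigma> ` B"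
    by (metis finite_subset_image)
  then show ?case using iso.IH[of B] locally_embeds_iso[OF iso.hyps(2,3) B(1)] by blast
next
  case (sub M N)
  have "A \<subseteq> univ M" using sub.prems(2) closed_subD(1)[OF sub.hyps(2)] by simp
  then show ?case
    using sub.IH[OF sub.prems(1)] locally_embeds_closed_sub[OF sub.hyps(2) sub.prems(2)] by blast
next
  case (chain_union K N)
  have "univ M1 \<subseteq> univ M2 \<or> univ M2 \<subseteq> univ M1" if "M1 \<in> K" "M2 \<in> K" for M1 M2
    using chain_union.hyps(3)[OF that] closed_subD(1)[of L M1 M2] closed_subD(1)[of L M2 M1] by blast
  then have chain: "subset.chain UNIV (univ ` K)" by (auto simp: subset_chain_def)
  have "A \<subseteq> \<Union>(univ ` K)" "univ ` K \<noteq> {}"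
    using chain_union.prems(2) chain_union.hyps(1,4) by auto
  then obtain U where "U \<in> univ ` K" "A \<subseteq> U"
    using finite_subset_Union_chain[OF chain_union.prems(1) _ _ chain] by blast
  then obtain M where M: "M \<in> K" "A \<subseteq> univ M" by blast
  then show ?case
    using chain_union.IH[OF M(1)] chain_union.prems
      locally_embeds_closed_sub[OF chain_union.hyps(5)[OF M(1)] M(2)] by blast
qed

section \<open>The quasiminimality axioms between two members\<close>

lemma zip_fst_snd: "set (zip (map fst ps) (map snd ps)) = set ps"
  by (simp add: zip_map_fst_snd)

lemma QM1_partial_iso:
  assumes "QM1 L M" "finite p" "p \<subseteq> univ M \<times> univ M" "a \<in> univ M" "a' \<in> univ M"
    "partial_iso L M M (insert (a, a') p)"
  shows "a \<in> cl M (fst ` p) \<longleftrightarrow> a' \<in> cl M (snd ` p)"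
proof -
  obtain ps where ps: "set ps = p" using finite_list[OF assms(2)] by blast
  have "tp L M (a # map fst ps) = tp L M (a' # map snd ps)"
    using assms(6) ps by (simp add: tp_eq_iff zip_fst_snd)
  moreover have "set (map fst ps) \<subseteq> univ M" "set (map snd ps) \<subseteq> univ M"
    using ps assms(3) by auto
  ultimately have "a \<in> cl M (set (map fst ps)) \<longleftrightarrow> a' \<in> cl M (set (map snd ps))"
    using assms(1,4,5) unfolding QM1_def by (metis insert_subset list.simps(15))
  then show ?thesis using ps by simp
qed

lemma QM5_partial_iso:
  assumes "QM5 L M" "finite p" "p \<subseteq> univ M \<times> univ M" "partial_iso L M M p" "a \<in> cl M (fst ` p)"
  shows "\<exists>a' \<in> univ M. partial_iso L M M (insert (a, a') p)"
proof -
  obtain ps where ps: "set ps = p" using finite_list[OF assms(2)] by blast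
  let ?bs = "map fst ps" and ?bs' = "map snd ps" and ?e = "\<lambda>_ :: nat. undefined :: 'c"
  have len: "length ?bs = length ?bs'" by simp
  have "tp_ext L M {} ?e ?bs = tp_ext L M {} ?e ?bs'"
    using assms(4) ps by (simp add: tp_ext_eq_iff[OF len] zip_fst_snd)
  moreover have "set ?bs \<subseteq> univ M" "set ?bs' \<subseteq> univ M" using ps assms(3) by auto
  moreover have "a \<in> cl M (?e ` {} \<union> set ?bs)" using ps assms(5) by simp
  ultimately obtain a' where a': "a' \<in> univ M"
    "tp_ext L M {} ?e (?bs @ [a]) = tp_ext L M {} ?e (?bs' @ [a'])"
    using assms(1) unfolding QM5_def by (metis image_empty)
  then have "partial_iso L M M (set (zip (?bs @ [a]) (?bs' @ [a'])))"
    by (subst (asm) tp_ext_eq_iff) auto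
  then show ?thesis using a'(1) ps by (auto simp: zip_fst_snd)
qed

text \<open>The relation \<open>G\<close> is itself countable, so its elements can serve as the common indices of the
  enumerations of the two closed sets.\<close>

lemma QM4_partial_iso:
  assumes "QM4 L M" "countable G" "partial_iso L M M G"
    "closed_in M (fst ` G)" "closed_in M (snd ` G)"
    "a \<in> univ M - fst ` G" "a' \<in> univ M - snd ` G"
  shows "partial_iso L M M (insert (a, a') G)"
proof -
  let ?I = "to_nat_on G ` G" and ?\<alpha> = "\<lambda>n. fst (from_nat_into G n)"
    and ?\<alpha>' = "\<lambda>n. snd (from_nat_into G n)"
  have im: "?\<alpha> ` ?I = fst ` G" "?\<alpha>' ` ?I = snd ` G" "(\<lambda>n. (?\<alpha> n, ?\<alpha>' n)) ` ?I = G"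
    using assms(2) by (force simp: image_iff)+
  then have "qf_type L M ?I ?\<alpha> = qf_type L M ?I ?\<alpha>'"
    using assms(3) by (simp add: qf_type_eq_iff)
  then have "tp_ext L M ?I ?\<alpha> [a] = tp_ext L M ?I ?\<alpha>' [a']"
    using assms(1,4-7) im(1,2) unfolding QM4_def by metis
  then show ?thesis using im(3) by (simp add: tp_ext_eq_iff)
qed

text \<open>The closures of the finite sets \<open>fst ` p\<close> and \<open>snd ` p\<close> are countable by QM3. QM5 adds any
  element of the one closure to the domain and, by symmetry, any element of the other to the
  range; QM1 keeps the images inside the closures. Alternating along enumerations of both closures
  exhausts them.\<close>

lemma partial_iso_extends_to_closures:
  assumes wqm: "weakly_quasiminimal L M" and p: "finite p" "p \<subseteq> univ M \<times> univ M" "partial_iso L M M p"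
  shows "\<exists>G. p \<subseteq> G \<and> countable G \<and> partial_iso L M M G \<and>
    fst ` G = cl M (fst ` p) \<and> snd ` G = cl M (snd ` p)"
proof -
  let ?A = "cl M (fst ` p)" and ?B = "cl M (snd ` p)"
  have pg: "pregeometry (univ M) (cl M)" and QM: "QM1 L M" "QM3 M" "QM5 L M"
    using wqm by (auto simp: weakly_quasiminimal_def is_pgstruct_def)
  have psub: "fst ` p \<subseteq> univ M" "snd ` p \<subseteq> univ M" using p(2) by auto
  have count: "countable ?A" "countable ?B" using QM(2) psub p(1) by (auto simp: QM3_def)
  have AB: "?A \<subseteq> univ M" "?B \<subseteq> univ M" using psub cl_subset[OF pg] by auto
  define ok where "ok q \<longleftrightarrow> finite q \<and> p \<subseteq> q \<and> q \<subseteq> ?A \<times> ?B \<and> partial_iso L M M q" for q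
  have cl_eq: "cl M (fst ` q) = ?A" "cl M (snd ` q) = ?B" if "ok q" for q
  proof -
    have "fst ` p \<subseteq> fst ` q" "snd ` p \<subseteq> snd ` q" "fst ` q \<subseteq> ?A" "snd ` q \<subseteq> ?B"
      using that by (auto simp: ok_def)
    with psub AB show "cl M (fst ` q) = ?A" "cl M (snd ` q) = ?B"
      by (intro antisym cl_least[OF pg] cl_mono[OF pg]; auto)+
  qed
  have extend_left: "\<exists>r. ok r \<and> q \<subseteq> r \<and> a \<in> fst ` r" if q: "ok q" and a: "a \<in> ?A" for q a
  proof -
    have qp: "finite q" "q \<subseteq> univ M \<times> univ M" "partial_iso L M M q" using q AB by (auto simp: ok_def)
    moreover have "a \<in> cl M (fst ` q)" using a cl_eq(1)[OF q] by simp
    ultimately obtain a' where a': "a' \<in> univ M" "partial_iso L M M (insert (a, a') q)"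
      using QM5_partial_iso[OF QM(3)] by blast
    have "a \<in> univ M" using a AB(1) by blast
    then have "a' \<in> ?B"
      using QM1_partial_iso[OF QM(1) qp(1,2) _ a'] a cl_eq[OF q] by simp
    then have "ok (insert (a, a') q)" using q a a' by (auto simp: ok_def)
    then show ?thesis by (intro exI[of _ "insert (a, a') q"]) auto
  qed
  have extend_right: "\<exists>r. ok r \<and> q \<subseteq> r \<and> b \<in> snd ` r" if q: "ok q" and b: "b \<in> ?B" for q b
  proof -
    have qp: "finite (q\<inverse>)" "q\<inverse> \<subseteq> univ M \<times> univ M" "partial_iso L M M (q\<inverse>)"
      using q AB partial_iso_converse by (auto simp: ok_def)
    have im: "fst ` (q\<inverse>) = snd ` q" "snd ` (q\<inverse>) = fst ` q" by force+
    have "b \<in> cl M (fst ` (q\<inverse>))" using b cl_eq(2)[OF q] im by simp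
    then obtain b' where b': "b' \<in> univ M" "partial_iso L M M (insert (b, b') (q\<inverse>))"
      using QM5_partial_iso[OF QM(3) qp] by blast
    have "b \<in> univ M" using b AB(2) by blast
    then have "b' \<in> ?A"
      using QM1_partial_iso[OF QM(1) qp(1,2) _ b'] b cl_eq[OF q] im by simp
    moreover have "partial_iso L M M (insert (b', b) q)"
      using partial_iso_converse[OF b'(2)] by (rule partial_iso_mono) auto
    ultimately have "ok (insert (b', b) q)" using q b by (auto simp: ok_def)
    then show ?thesis by (intro exI[of _ "insert (b', b) q"]) auto
  qed
  \<comment> \<open>\<^const>\<open>from_nat_into\<close> enumerates nonempty sets only, and a closure may be empty.\<close>
  have step: "\<exists>r. ok r \<and> q \<subseteq> r \<and> (?A \<noteq> {} \<longrightarrow> from_nat_into ?A n \<in> fst ` r) \<and>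
      (?B \<noteq> {} \<longrightarrow> from_nat_into ?B n \<in> snd ` r)" if q: "ok q" for q n
  proof -
    obtain r where r: "ok r" "q \<subseteq> r" "?A \<noteq> {} \<longrightarrow> from_nat_into ?A n \<in> fst ` r"
      using extend_left[OF q from_nat_into[of ?A n]] q by (cases "?A = {}") blast+
    obtain s where s: "ok s" "r \<subseteq> s" "?B \<noteq> {} \<longrightarrow> from_nat_into ?B n \<in> snd ` s"
      using extend_right[OF r(1) from_nat_into[of ?B n]] r(1) by (cases "?B = {}") blast+
    then show ?thesis using r by (intro exI[of _ s]) auto
  qed
  have "ok p" using p cl_extensive[OF pg psub(1)] cl_extensive[OF pg psub(2)]
    by (force simp: ok_def)
  then have "\<exists>f. \<forall>n. ok (f n) \<and> f n \<subseteq> f (Suc n) \<and>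
      (?A \<noteq> {} \<longrightarrow> from_nat_into ?A n \<in> fst ` f (Suc n)) \<and>
      (?B \<noteq> {} \<longrightarrow> from_nat_into ?B n \<in> snd ` f (Suc n))"
    using step by (intro dependent_nat_choice) blast+
  then obtain f where ok: "\<And>n. ok (f n)" and mono: "\<And>n. f n \<subseteq> f (Suc n)"
    and inA: "\<And>n. ?A \<noteq> {} \<Longrightarrow> from_nat_into ?A n \<in> fst ` f (Suc n)"
    and inB: "\<And>n. ?B \<noteq> {} \<Longrightarrow> from_nat_into ?B n \<in> snd ` f (Suc n)"
    by blast
  let ?G = "\<Union>n. f n"
  have "f n \<subseteq> ?A \<times> ?B" for n using ok[of n] by (simp add: ok_def)
  then have GAB: "?G \<subseteq> ?A \<times> ?B" by blast
  then have "countable ?G" using count by (meson countable_SIGMA countable_subset)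
  moreover have "partial_iso L M M ?G" using ok mono by (intro partial_iso_UN) (auto simp: ok_def)
  moreover have "p \<subseteq> ?G" using ok[of 0] by (auto simp: ok_def)
  moreover have "?A \<subseteq> fst ` ?G"
  proof
    fix a assume a: "a \<in> ?A"
    then obtain n where "a = from_nat_into ?A n" using from_nat_into_surj[OF count(1)] by metis
    then have "a \<in> fst ` f (Suc n)" using inA[of n] a by blast
    then show "a \<in> fst ` ?G" by blast
  qed
  moreover have "?B \<subseteq> snd ` ?G"
  proof
    fix b assume b: "b \<in> ?B"
    then obtain n where "b = from_nat_into ?B n" using from_nat_into_surj[OF count(2)] by metis
    then have "b \<in> snd ` f (Suc n)" using inB[of n] b by blast
    then show "b \<in> snd ` ?G" by blast
  qed
  moreover have "fst ` ?G \<subseteq> ?A" "snd ` ?G \<subseteq> ?B" using GAB by auto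
  ultimately show ?thesis by (intro exI[of _ ?G]) auto
qed

text \<open>QM4 compares generic elements over closed sets, whence the passage to the closures.\<close>

lemma partial_iso_insert_generic_same:
  assumes wqm: "weakly_quasiminimal L M" and p: "finite p" "p \<subseteq> univ M \<times> univ M" "partial_iso L M M p"
    and a: "a \<in> univ M" "a \<notin> cl M (fst ` p)" "a' \<in> univ M" "a' \<notin> cl M (snd ` p)"
  shows "partial_iso L M M (insert (a, a') p)"
proof -
  have pg: "pregeometry (univ M) (cl M)" and QM4: "QM4 L M"
    using wqm by (auto simp: weakly_quasiminimal_def is_pgstruct_def)
  have psub: "fst ` p \<subseteq> univ M" "snd ` p \<subseteq> univ M" using p(2) by auto
  obtain G where G: "p \<subseteq> G" "countable G" "partial_iso L M M G"
    "fst ` G = cl M (fst ` p)" "snd ` G = cl M (snd ` p)"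
    using partial_iso_extends_to_closures[OF wqm p] by blast
  have "closed_in M (fst ` G)" "closed_in M (snd ` G)"
    using psub cl_subset[OF pg] cl_idem[OF pg] by (simp_all add: closed_in_def G(4,5))
  then have "partial_iso L M M (insert (a, a') G)"
    using QM4_partial_iso[OF QM4 G(2,3)] a G(4,5) by auto
  then show ?thesis by (rule partial_iso_mono) (use G(1) in auto)
qed

lemma locally_embedsD:
  assumes "locally_embeds L M M0 A \<theta>" "pregeometry (univ M) (cl M)" "A \<subseteq> univ M"
  shows "inj_on \<theta> (cl M A)" "\<theta> ` cl M A \<subseteq> univ M0" "A \<subseteq> cl M A"
    "partial_iso L M M0 ((\<lambda>x. (x, \<theta> x)) ` cl M A)"
    "B \<subseteq> cl M A \<Longrightarrow> x \<in> cl M A \<Longrightarrow> \<theta> x \<in> cl M0 (\<theta> ` B) \<longleftrightarrow> x \<in> cl M B"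
proof -
  have iso: "partial_iso L M M0 ((\<lambda>x. (x, \<theta> x)) ` cl M A)"
    using assms(1) by (simp add: locally_embeds_def)
  then show "partial_iso L M M0 ((\<lambda>x. (x, \<theta> x)) ` cl M A)" .
  show inj: "inj_on \<theta> (cl M A)"
  proof (rule inj_onI)
    fix x y assume "x \<in> cl M A" "y \<in> cl M A" "\<theta> x = \<theta> y"
    then show "x = y" using partial_iso_eq_iff[OF iso, of x "\<theta> x" y "\<theta> y"] by blast
  qed
  show "\<theta> ` cl M A \<subseteq> univ M0" using assms(1) by (simp add: locally_embeds_def)
  show "A \<subseteq> cl M A" using cl_extensive[OF assms(2,3)] .
  assume B: "B \<subseteq> cl M A" and x: "x \<in> cl M A"
  have "cl M B \<subseteq> cl M A" using cl_least[OF assms(2) B assms(3)] .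
  moreover have "\<theta> ` cl M B = cl M0 (\<theta> ` B)" using assms(1) B by (simp add: locally_embeds_def)
  ultimately show "\<theta> x \<in> cl M0 (\<theta> ` B) \<longleftrightarrow> x \<in> cl M B"
    using inj x by (metis inj_on_image_mem_iff)
qed

text \<open>Each of the following transfers from \<open>M0\<close>: the finitely many elements concerned are moved into
  \<open>M0\<close> by local embeddings of their closures.\<close>

context
  fixes L :: "('f, 'r) language" and M0 M N :: "('f, 'r, 'a) pgstruct"
  assumes wqm: "weakly_quasiminimal L M0"
    and M: "M \<in> generated_class L M0" and N: "N \<in> generated_class L M0"
begin

lemma pregeometry_members: "pregeometry (univ M) (cl M)" "pregeometry (univ N) (cl N)"
  using is_pgstruct_generated_class[OF M] is_pgstruct_generated_class[OF N] wqm
  by (auto simp: weakly_quasiminimal_def is_pgstruct_def)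

lemma local_embeddings:
  assumes "finite A" "A \<subseteq> univ M" "finite B" "B \<subseteq> univ N"
  obtains \<theta> \<theta>' where "locally_embeds L M M0 A \<theta>" "locally_embeds L N M0 B \<theta>'"
  using generated_class_locally_embeds[OF M _ assms(1,2)]
    generated_class_locally_embeds[OF N _ assms(3,4)] wqm
  by (auto simp: weakly_quasiminimal_def)

lemma partial_iso_transport:
  assumes "locally_embeds L M M0 A \<theta>" "locally_embeds L N M0 B \<theta>'" "p \<subseteq> cl M A \<times> cl N B"
  shows "partial_iso L M0 M0 (map_prod \<theta> \<theta>' ` p) \<longleftrightarrow> partial_iso L M N p"
proof
  let ?g = "(\<lambda>x. (x, \<theta> x)) ` cl M A" and ?h = "(\<lambda>x. (x, \<theta>' x)) ` cl N B"
  have g: "partial_iso L M M0 ?g" and h: "partial_iso L N M0 ?h"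
    using assms by (simp_all add: locally_embeds_def)
  show "partial_iso L M0 M0 (map_prod \<theta> \<theta>' ` p)" if "partial_iso L M N p"
    using partial_iso_comp[OF partial_iso_comp[OF partial_iso_converse[OF g] that] h]
    by (rule partial_iso_mono) (use assms(3) in fastforce)
  show "partial_iso L M N p" if "partial_iso L M0 M0 (map_prod \<theta> \<theta>' ` p)"
    using partial_iso_comp[OF partial_iso_comp[OF g that] partial_iso_converse[OF h]]
    by (rule partial_iso_mono) (use assms(3) in fastforce)
qed

lemma map_prod_subset_univ:
  assumes "locally_embeds L M M0 A \<theta>" "locally_embeds L N M0 B \<theta>'" "p \<subseteq> cl M A \<times> cl N B"
  shows "map_prod \<theta> \<theta>' ` p \<subseteq> univ M0 \<times> univ M0"
proof -
  have "map_prod \<theta> \<theta>' ` p \<subseteq> \<theta> ` cl M A \<times> \<theta>' ` cl N B" using assms(3) by auto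
  then show ?thesis using assms(1,2) by (auto simp: locally_embeds_def)
qed

lemma partial_iso_cl_iff:
  assumes p: "finite p" "p \<subseteq> univ M \<times> univ N" and a: "a \<in> univ M" "a' \<in> univ N"
    and iso: "partial_iso L M N (insert (a, a') p)"
  shows "a \<in> cl M (fst ` p) \<longleftrightarrow> a' \<in> cl N (snd ` p)"
proof -
  let ?A = "insert a (fst ` p)" and ?B = "insert a' (snd ` p)"
  have sub: "?A \<subseteq> univ M" "?B \<subseteq> univ N" using p a by auto
  obtain \<theta> \<theta>' where \<theta>: "locally_embeds L M M0 ?A \<theta>" and \<theta>': "locally_embeds L N M0 ?B \<theta>'"
    using local_embeddings[OF _ sub(1) _ sub(2)] p(1) by blast
  note e = locally_embedsD[OF \<theta> pregeometry_members(1) sub(1)]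
  note e' = locally_embedsD[OF \<theta>' pregeometry_members(2) sub(2)]
  let ?q = "map_prod \<theta> \<theta>' ` p"
  have psub: "insert (a, a') p \<subseteq> cl M ?A \<times> cl N ?B" using e(3) e'(3) by force
  then have "partial_iso L M0 M0 (insert (\<theta> a, \<theta>' a') ?q)" "?q \<subseteq> univ M0 \<times> univ M0"
    "\<theta> a \<in> univ M0" "\<theta>' a' \<in> univ M0"
    using partial_iso_transport[OF \<theta> \<theta>' psub] iso map_prod_subset_univ[OF \<theta> \<theta>' psub] by simp_all
  then have "\<theta> a \<in> cl M0 (fst ` ?q) \<longleftrightarrow> \<theta>' a' \<in> cl M0 (snd ` ?q)"
    using QM1_partial_iso[of L M0 ?q] wqm p(1) by (auto simp: weakly_quasiminimal_def)
  moreover have "fst ` ?q = \<theta> ` fst ` p" "snd ` ?q = \<theta>' ` snd ` p" by force+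
  ultimately show ?thesis
    using e(5)[of "fst ` p" a] e'(5)[of "snd ` p" a'] e(3) e'(3) by simp
qed

lemma partial_iso_extend_cl:
  assumes p: "finite p" "p \<subseteq> univ M \<times> univ N" "partial_iso L M N p" and a: "a \<in> cl M (fst ` p)"
  shows "\<exists>a' \<in> univ N. partial_iso L M N (insert (a, a') p)"
proof -
  let ?A = "fst ` p" and ?B = "snd ` p"
  have sub: "?A \<subseteq> univ M" "?B \<subseteq> univ N" using p by auto
  obtain \<theta> \<theta>' where \<theta>: "locally_embeds L M M0 ?A \<theta>" and \<theta>': "locally_embeds L N M0 ?B \<theta>'"
    using local_embeddings[OF _ sub(1) _ sub(2)] p(1) by blast
  note e = locally_embedsD[OF \<theta> pregeometry_members(1) sub(1)]
  note e' = locally_embedsD[OF \<theta>' pregeometry_members(2) sub(2)]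
  have QM: "QM1 L M0" "QM5 L M0" using wqm by (simp_all add: weakly_quasiminimal_def)
  let ?q = "map_prod \<theta> \<theta>' ` p"
  have psub: "p \<subseteq> cl M ?A \<times> cl N ?B" using e(3) e'(3) by force
  have q: "finite ?q" "?q \<subseteq> univ M0 \<times> univ M0" "partial_iso L M0 M0 ?q"
    using partial_iso_transport[OF \<theta> \<theta>' psub] p map_prod_subset_univ[OF \<theta> \<theta>' psub] by simp_all
  have im: "fst ` ?q = \<theta> ` fst ` p" "snd ` ?q = \<theta>' ` snd ` p" by force+
  have a0: "\<theta> a \<in> cl M0 (fst ` ?q)" using e(5)[OF e(3) a] a im by simp
  obtain b where b: "b \<in> univ M0" "partial_iso L M0 M0 (insert (\<theta> a, b) ?q)"
    using QM5_partial_iso[OF QM(2) q a0] by blast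
  have "\<theta> a \<in> univ M0" using e(2) a by blast
  \<comment> \<open>The image found in \<open>M0\<close> comes from \<open>N\<close>, because by QM1 it lies in a closure that \<open>\<theta>'\<close> covers.\<close>
  then have "b \<in> cl M0 (\<theta>' ` ?B)" using QM1_partial_iso[OF QM(1) q(1,2) _ b] a0 im by simp
  moreover have "\<theta>' ` cl N ?B = cl M0 (\<theta>' ` ?B)" using \<theta>' e'(3) by (simp add: locally_embeds_def)
  ultimately obtain a' where a': "a' \<in> cl N ?B" "b = \<theta>' a'" by auto
  then have "partial_iso L M N (insert (a, a') p)"
    using partial_iso_transport[OF \<theta> \<theta>', of "insert (a, a') p"] b(2) a psub by simp
  moreover have "a' \<in> univ N" using a' cl_subset[OF pregeometry_members(2) sub(2)] by blast
  ultimately show ?thesis by blast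
qed

lemma partial_iso_insert_generic:
  assumes p: "finite p" "p \<subseteq> univ M \<times> univ N" "partial_iso L M N p"
    and a: "a \<in> univ M" "a \<notin> cl M (fst ` p)" "a' \<in> univ N" "a' \<notin> cl N (snd ` p)"
  shows "partial_iso L M N (insert (a, a') p)"
proof -
  let ?A = "insert a (fst ` p)" and ?B = "insert a' (snd ` p)"
  have sub: "?A \<subseteq> univ M" "?B \<subseteq> univ N" using p a by auto
  obtain \<theta> \<theta>' where \<theta>: "locally_embeds L M M0 ?A \<theta>" and \<theta>': "locally_embeds L N M0 ?B \<theta>'"
    using local_embeddings[OF _ sub(1) _ sub(2)] p(1) by blast
  note e = locally_embedsD[OF \<theta> pregeometry_members(1) sub(1)]
  note e' = locally_embedsD[OF \<theta>' pregeometry_members(2) sub(2)]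
  let ?q = "map_prod \<theta> \<theta>' ` p"
  have psub: "insert (a, a') p \<subseteq> cl M ?A \<times> cl N ?B" using e(3) e'(3) by force
  then have q: "finite ?q" "?q \<subseteq> univ M0 \<times> univ M0" "partial_iso L M0 M0 ?q"
    "\<theta> a \<in> univ M0" "\<theta>' a' \<in> univ M0"
    using partial_iso_transport[OF \<theta> \<theta>', of p] p map_prod_subset_univ[OF \<theta> \<theta>' psub] by simp_all
  have im: "fst ` ?q = \<theta> ` fst ` p" "snd ` ?q = \<theta>' ` snd ` p" by force+
  have "\<theta> a \<notin> cl M0 (fst ` ?q)" "\<theta>' a' \<notin> cl M0 (snd ` ?q)"
    using e(5)[of "fst ` p" a] e'(5)[of "snd ` p" a'] e(3) e'(3) a im by auto
  then have "partial_iso L M0 M0 (insert (\<theta> a, \<theta>' a') ?q)"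
    using partial_iso_insert_generic_same[OF wqm q(1-3)] q(4,5) by blast
  then show ?thesis using partial_iso_transport[OF \<theta> \<theta>' psub] by simp
qed

end

section \<open>Back and forth between H-structures\<close>

definition H_partial_iso ::
  "('f, 'r) language \<Rightarrow> ('f, 'r, 'a) pgstruct \<Rightarrow> 'a set \<Rightarrow> ('f, 'r, 'a) pgstruct \<Rightarrow> 'a set
    \<Rightarrow> ('a \<times> 'a) set \<Rightarrow> bool" where
  "H_partial_iso L M H N H' p \<longleftrightarrow> finite p \<and> p \<subseteq> univ M \<times> univ N \<and> partial_iso L M N p \<and>
    (\<forall>(x, y) \<in> p. x \<in> H \<longleftrightarrow> y \<in> H') \<and>
    H_indep_set (cl M) H (fst ` p) \<and> H_indep_set (cl N) H' (snd ` p)"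

lemma H_partial_iso_converse:
  "H_partial_iso L M H N H' p \<Longrightarrow> H_partial_iso L N H' M H (p\<inverse>)"
proof -
  have "fst ` (p\<inverse>) = snd ` p" "snd ` (p\<inverse>) = fst ` p" by force+
  then show "H_partial_iso L M H N H' p \<Longrightarrow> H_partial_iso L N H' M H (p\<inverse>)"
    unfolding H_partial_iso_def by (auto intro: partial_iso_converse)
qed

context
  fixes L :: "('f, 'r) language" and M0 M N :: "('f, 'r, 'a) pgstruct" and H H' :: "'a set"
  assumes wqm: "weakly_quasiminimal L M0"
    and M: "M \<in> generated_class L M0" and N: "N \<in> generated_class L M0"
    and dcM: "dense_codense M H" and dcN: "dense_codense N H'"
begin

lemma H_sub: "H \<subseteq> univ M" "H' \<subseteq> univ N"
  using dcM dcN by (simp_all add: dense_codense_def)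

lemma pg_members: "pregeometry (univ M) (cl M)" "pregeometry (univ N) (cl N)"
  using pregeometry_members[OF wqm M N] .

text \<open>The image \<open>b'\<close> is provided without regard to \<open>H\<close>. If one of \<open>b\<close>, \<open>b'\<close> is in the predicate, it is
  already an entry of the given relation by \<open>H_indep_set_cl_inter_H\<close>; single-valuedness then
  identifies the other with its partner there, for which \<open>H\<close> is respected.\<close>

lemma H_partial_iso_extend_cl:
  assumes p: "H_partial_iso L M H N H' p" and b: "b \<in> cl M (fst ` p)"
  shows "\<exists>b'. H_partial_iso L M H N H' (insert (b, b') p)"
proof -
  have p': "finite p" "p \<subseteq> univ M \<times> univ N" "partial_iso L M N p"
    and H: "\<And>x y. (x, y) \<in> p \<Longrightarrow> x \<in> H \<longleftrightarrow> y \<in> H'"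
    and indep: "H_indep_set (cl M) H (fst ` p)" "H_indep_set (cl N) H' (snd ` p)"
    using p by (auto simp: H_partial_iso_def)
  have sub: "fst ` p \<subseteq> univ M" "snd ` p \<subseteq> univ N" using p'(2) by auto
  obtain b' where b': "b' \<in> univ N" "partial_iso L M N (insert (b, b') p)"
    using partial_iso_extend_cl[OF wqm M N p' b] by blast
  have bM: "b \<in> univ M" using b cl_subset[OF pg_members(1) sub(1)] by blast
  then have b'cl: "b' \<in> cl N (snd ` p)"
    using partial_iso_cl_iff[OF wqm M N p'(1,2) _ b'] b by simp
  have "b' \<in> H'" if bH: "b \<in> H"
  proof -
    obtain y where "(b, y) \<in> p"
      using H_indep_set_cl_inter_H[OF pg_members(1) sub(1) H_sub(1) indep(1) b bH] by auto
    then show ?thesis using partial_iso_eq_iff[OF b'(2), of b b' b y] H bH by auto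
  qed
  moreover have "b \<in> H" if b'H: "b' \<in> H'"
  proof -
    obtain x where "(x, b') \<in> p"
      using H_indep_set_cl_inter_H[OF pg_members(2) sub(2) H_sub(2) indep(2) b'cl b'H] by auto
    then show ?thesis using partial_iso_eq_iff[OF b'(2), of b b' x b'] H b'H by auto
  qed
  moreover have "H_indep_set (cl M) H (insert b (fst ` p))" "H_indep_set (cl N) H' (insert b' (snd ` p))"
    using H_indep_set_insert_cl[OF pg_members(1) sub(1) H_sub(1) indep(1) b]
      H_indep_set_insert_cl[OF pg_members(2) sub(2) H_sub(2) indep(2) b'cl] .
  ultimately show ?thesis using p'(1,2) bM b' H
    by (intro exI[of _ b']) (auto simp: H_partial_iso_def)
qed

lemma H_partial_iso_extend_H:
  assumes p: "H_partial_iso L M H N H' p" and b: "b \<in> H"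
  shows "\<exists>b'. H_partial_iso L M H N H' (insert (b, b') p)"
proof (cases "b \<in> cl M (fst ` p)")
  case True
  then show ?thesis using H_partial_iso_extend_cl[OF p] by blast
next
  case False
  have p': "finite p" "p \<subseteq> univ M \<times> univ N" "partial_iso L M N p"
    and H: "\<And>x y. (x, y) \<in> p \<Longrightarrow> x \<in> H \<longleftrightarrow> y \<in> H'"
    and indep: "H_indep_set (cl M) H (fst ` p)" "H_indep_set (cl N) H' (snd ` p)"
    using p by (auto simp: H_partial_iso_def)
  have sub: "fst ` p \<subseteq> univ M" "snd ` p \<subseteq> univ N" using p'(2) by auto
  obtain bs where bs: "set bs = snd ` p" using p'(1) finite_list[of "snd ` p"] by auto
  obtain b' where b': "b' \<in> H'" "b' \<notin> cl N (snd ` p)"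
    using dcN sub(2) unfolding dense_codense_def bs[symmetric] by blast
  have "partial_iso L M N (insert (b, b') p)"
    using partial_iso_insert_generic[OF wqm M N p' _ False _ b'(2)] b b'(1) H_sub by blast
  moreover have "H_indep_set (cl M) H (insert b (fst ` p))" "H_indep_set (cl N) H' (insert b' (snd ` p))"
    using H_indep_set_insert_H[OF pg_members(1) sub(1) H_sub(1) indep(1) b]
      H_indep_set_insert_H[OF pg_members(2) sub(2) H_sub(2) indep(2) b'(1)] .
  ultimately show ?thesis using p'(1,2) b b'(1) H H_sub
    by (intro exI[of _ b']) (auto simp: H_partial_iso_def)
qed

lemma H_partial_iso_extend_generic:
  assumes p: "H_partial_iso L M H N H' p" and b: "b \<in> univ M" "b \<notin> cl M (fst ` p \<union> H)"
  shows "\<exists>b'. H_partial_iso L M H N H' (insert (b, b') p)"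
proof -
  have p': "finite p" "p \<subseteq> univ M \<times> univ N" "partial_iso L M N p"
    and H: "\<And>x y. (x, y) \<in> p \<Longrightarrow> x \<in> H \<longleftrightarrow> y \<in> H'"
    and indep: "H_indep_set (cl M) H (fst ` p)" "H_indep_set (cl N) H' (snd ` p)"
    using p by (auto simp: H_partial_iso_def)
  have sub: "fst ` p \<subseteq> univ M" "snd ` p \<subseteq> univ N" using p'(2) by auto
  obtain bs where bs: "set bs = snd ` p" using p'(1) finite_list[of "snd ` p"] by auto
  obtain b' where b': "b' \<in> univ N" "b' \<notin> cl N (snd ` p \<union> H')"
    using dcN sub(2) unfolding dense_codense_def bs[symmetric] by blast
  have subH: "fst ` p \<union> H \<subseteq> univ M" "snd ` p \<union> H' \<subseteq> univ N" using sub H_sub by auto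
  have "b \<notin> H" "b' \<notin> H'"
    using b(2) b'(2) cl_extensive[OF pg_members(1) subH(1)] cl_extensive[OF pg_members(2) subH(2)] by auto
  moreover have "b \<notin> cl M (fst ` p)" "b' \<notin> cl N (snd ` p)"
    using b(2) b'(2) cl_mono[OF pg_members(1) _ subH(1), of "fst ` p"]
      cl_mono[OF pg_members(2) _ subH(2), of "snd ` p"] by auto
  then have "partial_iso L M N (insert (b, b') p)"
    using partial_iso_insert_generic[OF wqm M N p'] b(1) b'(1) by blast
  moreover have "H_indep_set (cl M) H (insert b (fst ` p))" "H_indep_set (cl N) H' (insert b' (snd ` p))"
    using H_indep_set_insert_generic[OF pg_members(1) sub(1) H_sub(1) indep(1) b]
      H_indep_set_insert_generic[OF pg_members(2) sub(2) H_sub(2) indep(2) b'] .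
  ultimately show ?thesis using p'(1,2) b(1) b'(1) H
    by (intro exI[of _ b']) (auto simp: H_partial_iso_def)
qed

text \<open>An element of the closure of the domain together with \<open>H\<close> depends on finitely many elements of
  \<open>H\<close>, which have to enter the domain before it: the set extended by this element alone need not be
  \<open>H\<close>-independent.\<close>

lemma H_partial_iso_extend:
  assumes p: "H_partial_iso L M H N H' p" and b: "b \<in> univ M"
  shows "\<exists>q b'. H_partial_iso L M H N H' q \<and> p \<subseteq> q \<and> (b, b') \<in> q"
proof (cases "b \<in> cl M (fst ` p \<union> H)")
  case False
  then show ?thesis using H_partial_iso_extend_generic[OF p b] by blast
next
  case True
  have sub: "fst ` p \<subseteq> univ M" using p by (auto simp: H_partial_iso_def)
  then obtain F where F: "F \<subseteq> fst ` p \<union> H" "finite F" "b \<in> cl M F"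
    using cl_finitary[OF pg_members(1) _ True] H_sub(1) by auto
  have "\<exists>q. H_partial_iso L M H N H' q \<and> p \<subseteq> q \<and> E \<subseteq> fst ` q" if "finite E" "E \<subseteq> H" for E
    using that
  proof (induction E)
    case empty
    then show ?case using p by blast
  next
    case (insert x E)
    then obtain q where q: "H_partial_iso L M H N H' q" "p \<subseteq> q" "E \<subseteq> fst ` q" by auto
    obtain x' where "H_partial_iso L M H N H' (insert (x, x') q)"
      using H_partial_iso_extend_H[OF q(1)] insert.prems by blast
    then show ?case using q by (intro exI[of _ "insert (x, x') q"]) auto
  qed
  from this[of "F \<inter> H"] obtain q
    where q: "H_partial_iso L M H N H' q" "p \<subseteq> q" "F \<inter> H \<subseteq> fst ` q" using F(2) by auto
  have "F \<subseteq> fst ` q" using F(1) q(2,3) by blast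
  moreover have "fst ` q \<subseteq> univ M" using q(1) by (auto simp: H_partial_iso_def)
  ultimately have "b \<in> cl M (fst ` q)" using F(3) cl_mono[OF pg_members(1)] by blast
  then obtain b' where "H_partial_iso L M H N H' (insert (b, b') q)"
    using H_partial_iso_extend_cl[OF q(1)] by blast
  then show ?thesis using q(2) by (intro exI[of _ "insert (b, b') q"]) auto
qed

end

lemma trm_val_expand_H: "trm_val (expand_H M H) e t = trm_val M e t"
proof (induction t)
  case (App f ts)
  then have eq: "map (trm_val (expand_H M H) e) ts = map (trm_val M e) ts" by auto
  show ?case by (simp only: trm_val.simps eq) (simp add: expand_H_def)
qed simp

lemma wf_trm_lang_H: "wf_trm (lang_H L) t = wf_trm L t"
  by (induction t) (auto simp: lang_H_def)

text \<open>The equation \<open>v = t\<close> with a fresh variable \<open>v\<close> is preserved.\<close>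

lemma H_partial_iso_trm_val:
  fixes e e' :: "nat \<Rightarrow> 'a"
  assumes q: "H_partial_iso L M H N H' q" and t: "wf_trm L t"
    and e: "\<forall>v \<in> fv_trm t. (e v, e' v) \<in> q" and c: "(trm_val M e t, c) \<in> q"
  shows "trm_val N e' t = c"
proof -
  obtain v where v: "v \<notin> fv_trm t"
    using finite_fv_trm[of t] ex_new_if_finite infinite_UNIV_nat by blast
  let ?e = "e(v := trm_val M e t)" and ?e' = "e'(v := c)"
  have "sat M (Eq (Var v) t) ?e \<longleftrightarrow> sat N (Eq (Var v) t) ?e'"
    using q t e c by (intro partial_isoD[of L M N q]) (auto simp: H_partial_iso_def)
  moreover have "trm_val M ?e t = trm_val M e t" "trm_val N ?e' t = trm_val N e' t"
    using v by (auto intro!: trm_val_cong)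
  ultimately show ?thesis by simp
qed

text \<open>Besides the quantifier, the atomic formulas \<open>H(t)\<close> also use an extension of the relation, since
  the value of the term \<open>t\<close> need not be in its domain.\<close>

lemma sat_H_partial_iso:
  fixes L :: "('f, 'r) language" and M0 M N :: "('f, 'r, 'a) pgstruct"
    and \<phi> :: "('f, 'r option, nat) fm"
  assumes wqm: "weakly_quasiminimal L M0"
    and M: "M \<in> generated_class L M0" and N: "N \<in> generated_class L M0"
    and dcM: "dense_codense M H" and dcN: "dense_codense N H'"
  shows "H_partial_iso L M H N H' p \<Longrightarrow> wf_fm (lang_H L) \<phi> \<Longrightarrow> \<forall>v \<in> fv_fm \<phi>. (e v, e' v) \<in> p \<Longrightarrow>
    sat (expand_H M H) \<phi> e = sat (expand_H N H') \<phi> e'"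
proof (induction \<phi> arbitrary: p e e')
  case (Eq s t)
  have "sat M (Eq s t) e \<longleftrightarrow> sat N (Eq s t) e'"
    using Eq by (intro partial_isoD[of L M N p]) (auto simp: H_partial_iso_def wf_trm_lang_H)
  then show ?case by (simp add: trm_val_expand_H)
next
  case (Rel r ts)
  show ?case
  proof (cases r)
    case (Some r')
    have "sat M (Rel r' ts) e \<longleftrightarrow> sat N (Rel r' ts) e'"
    proof (rule partial_isoD[of L M N p])
      have "\<forall>t \<in> set ts. wf_trm L t" using Rel.prems(2) by (simp add: wf_trm_lang_H)
      then show "wf_fm L (Rel r' ts)" using Rel.prems(2) Some by (auto simp: lang_H_def)
    qed (use Rel.prems in \<open>auto simp: H_partial_iso_def\<close>)
    moreover have "trm_val (expand_H M H) e = trm_val M e" "trm_val (expand_H N H') e' = trm_val N e'"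
      by (simp_all add: fun_eq_iff trm_val_expand_H)
    ultimately show ?thesis using Some by (simp add: expand_H_def)
  next
    case None
    then obtain t where ts: "ts = [t]" using Rel.prems(2) by (auto simp: lang_H_def length_Suc_conv)
    have t: "wf_trm L t" "\<forall>v \<in> fv_trm t. (e v, e' v) \<in> p"
      using Rel.prems(2,3) ts by (auto simp: wf_trm_lang_H)
    have "is_struct L M"
      using is_pgstruct_generated_class[OF M] wqm by (simp add: weakly_quasiminimal_def is_pgstruct_def)
    then have "trm_val M e t \<in> univ M"
      using t Rel.prems(1) by (intro trm_val_in_univ) (auto simp: H_partial_iso_def)
    then obtain q c where q: "H_partial_iso L M H N H' q" "p \<subseteq> q" "(trm_val M e t, c) \<in> q"
      using H_partial_iso_extend[OF wqm M N dcM dcN Rel.prems(1)] by blast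
    then have "trm_val N e' t = c"
      using t by (intro H_partial_iso_trm_val[OF q(1)]) auto
    then have "trm_val M e t \<in> H \<longleftrightarrow> trm_val N e' t \<in> H'"
      using q(1,3) by (auto simp: H_partial_iso_def)
    then show ?thesis using None ts by (simp add: trm_val_expand_H) (simp add: expand_H_def)
  qed
next
  case (Neg \<phi>)
  then show ?case by (metis fv_fm.simps(3) sat.simps(3) wf_fm.simps(3))
next
  case (And \<phi> \<psi>)
  have "sat (expand_H M H) \<phi> e = sat (expand_H N H') \<phi> e'"
    "sat (expand_H M H) \<psi> e = sat (expand_H N H') \<psi> e'"
    using And.prems by (intro And.IH[of p]; simp)+
  then show ?case by simp
next
  case (Conj \<Phi>)
  have "sat (expand_H M H) (\<Phi> n) e = sat (expand_H N H') (\<Phi> n) e'" for n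
    using Conj.prems by (intro Conj.IH[of "\<Phi> n" p]) auto
  then show ?case by simp
next
  case (Ex v \<phi>)
  have univ: "univ (expand_H M H) = univ M" "univ (expand_H N H') = univ N"
    by (simp_all add: expand_H_def)
  have step: "sat (expand_H M H) \<phi> (e(v := x)) = sat (expand_H N H') \<phi> (e'(v := y))"
    if "H_partial_iso L M H N H' q" "p \<subseteq> q" "(x, y) \<in> q" for q x y
    using that Ex.prems(2,3) by (intro Ex.IH[of q]) auto
  have in_univ: "x \<in> univ M \<and> y \<in> univ N" if "H_partial_iso L M H N H' q" "(x, y) \<in> q" for q x y
    using that by (auto simp: H_partial_iso_def)
  have "\<exists>y \<in> univ N. sat (expand_H N H') \<phi> (e'(v := y))"
    if "x \<in> univ M" "sat (expand_H M H) \<phi> (e(v := x))" for x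
    using H_partial_iso_extend[OF wqm M N dcM dcN Ex.prems(1) that(1)] step that(2) in_univ by metis
  moreover have "\<exists>x \<in> univ M. sat (expand_H M H) \<phi> (e(v := x))"
    if y: "y \<in> univ N" "sat (expand_H N H') \<phi> (e'(v := y))" for y
  proof -
    obtain q x where q: "H_partial_iso L N H' M H q" "p\<inverse> \<subseteq> q" "(y, x) \<in> q"
      using H_partial_iso_extend[OF wqm N M dcN dcM H_partial_iso_converse[OF Ex.prems(1)] y(1)] by blast
    then have "H_partial_iso L M H N H' (q\<inverse>)" "p \<subseteq> q\<inverse>" "(x, y) \<in> q\<inverse>"
      using H_partial_iso_converse[OF q(1)] by auto
    then show ?thesis using step in_univ y(2) by metis
  qed
  ultimately show ?case unfolding sat.simps univ by blast
qed

text \<open>The finite character of the closure reduces independence to finite subsets.\<close>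

lemma indep_of_distinct_lists:
  assumes pg: "pregeometry S c" and H: "H \<subseteq> S"
    and lists: "\<And>hs. distinct hs \<Longrightarrow> set hs \<subseteq> H \<Longrightarrow> indep c (set hs)"
  shows "indep c H"
  unfolding indep_def
proof (intro ballI notI)
  fix x assume x: "x \<in> H" "x \<in> c (H - {x})"
  then obtain F where F: "F \<subseteq> H - {x}" "finite F" "x \<in> c F"
    using cl_finitary[OF pg, of "H - {x}" x] H by blast
  then obtain hs where hs: "set hs = insert x F" "distinct hs"
    using finite_distinct_list[of "insert x F"] by auto
  have "indep c (insert x F)" using lists[of hs] hs F(1) x(1) by auto
  moreover have "insert x F - {x} = F" using F(1) by auto
  ultimately show False using F(3) by (auto simp: indep_def)
qed

lemma H_structure_indep:
  assumes "H_structure C M H" "pregeometry (univ M) (cl M)"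
  shows "indep (cl M) H"
  using assms indep_of_distinct_lists[OF assms(2), of H]
  by (auto simp: H_structure_def dense_codense_def)

lemma tp_H_eqI:
  fixes L :: "('f, 'r) language" and M0 M N :: "('f, 'r, 'a) pgstruct"
  assumes "weakly_quasiminimal L M0" "M \<in> generated_class L M0" "N \<in> generated_class L M0"
    "dense_codense M H" "dense_codense N H'"
    and p: "H_partial_iso L M H N H' p" and len: "length xs = length ys" and zip: "set (zip xs ys) \<subseteq> p"
  shows "tp_H L M H xs = tp_H L N H' ys"
proof -
  have "(xs ! i, ys ! i) \<in> p" if "i < length xs" for i
    using zip len that by (auto simp: set_zip)
  then have "sat (expand_H M H) \<phi> (nth xs) = sat (expand_H N H') \<phi> (nth ys)"
    if "wf_fm (lang_H L) \<phi>" "fv_fm \<phi> \<subseteq> {..<length xs}" for \<phi>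
    using that by (intro sat_H_partial_iso[OF assms(1-5) p]) auto
  then show ?thesis using len by (auto simp: tp_H_def inf_type_def)
qed

theorem proposition4p9:
  fixes L :: "('f, 'r) language"
    and C :: "('f, 'r, 'a) pgstruct set"
    and M N :: "('f, 'r, 'a) pgstruct"
    and H H' :: "'a set"
    and as as' :: "'a list"
  assumes "countable_language L"
    and "quasiminimal_class L C"
    and "H_structure C M H"
    and "H_structure C N H'"
    and "set as \<subseteq> univ M"
    and "set as' \<subseteq> univ N"
    and "H_independent M H as"
    and "H_independent N H' as'"
    and "same_tp_with_H L M H as N H' as'"
  shows "tp_H L M H as = tp_H L N H' as' \<and>
    (\<forall>b \<in> univ M. \<exists>b' \<in> univ N. tp_H L M H (as @ [b]) = tp_H L N H' (as' @ [b']))"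
proof -
  obtain M0 where wqm: "weakly_quasiminimal L M0" and C: "C = generated_class L M0"
    using assms(2) by (auto simp: quasiminimal_class_def quasiminimal_def)
  have M: "M \<in> generated_class L M0" "dense_codense M H"
    and N: "N \<in> generated_class L M0" "dense_codense N H'"
    using assms(3,4) by (simp_all add: H_structure_def C)
  note pg = pregeometry_members[OF wqm M(1) N(1)]
  have H_sub: "H \<subseteq> univ M" "H' \<subseteq> univ N" using M(2) N(2) by (simp_all add: dense_codense_def)
  let ?p = "set (zip as as')"
  have len: "length as = length as'" and iso: "partial_iso L M N ?p"
    using assms(9) by (simp_all add: same_tp_with_H_def tp_eq_iff)
  have im: "fst ` ?p = set as" "snd ` ?p = set as'"
    using len by (metis list.set_map map_fst_zip, metis list.set_map map_snd_zip)
  have "H_indep_set (cl M) H (set as)" "H_indep_set (cl N) H' (set as')"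
    using H_indep_setI[OF pg(1) assms(5) H_sub(1) H_structure_indep[OF assms(3) pg(1)]]
      H_indep_setI[OF pg(2) assms(6) H_sub(2) H_structure_indep[OF assms(4) pg(2)]] assms(7,8)
    by (simp_all add: H_independent_def)
  moreover have "\<forall>(x, y) \<in> ?p. x \<in> H \<longleftrightarrow> y \<in> H'"
    using assms(9) len by (auto simp: same_tp_with_H_def set_zip)
  moreover have "?p \<subseteq> univ M \<times> univ N" using assms(5,6) by (auto dest: set_zip_leftD set_zip_rightD)
  ultimately have p: "H_partial_iso L M H N H' ?p"
    using iso im by (simp add: H_partial_iso_def)
  note eqI = tp_H_eqI[OF wqm M(1) N(1) M(2) N(2)]
  have "\<exists>b' \<in> univ N. tp_H L M H (as @ [b]) = tp_H L N H' (as' @ [b'])" if b: "b \<in> univ M" for b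
  proof -
    obtain q b' where q: "H_partial_iso L M H N H' q" "?p \<subseteq> q" "(b, b') \<in> q"
      using H_partial_iso_extend[OF wqm M(1) N(1) M(2) N(2) p b] by blast
    then have "tp_H L M H (as @ [b]) = tp_H L N H' (as' @ [b'])"
      using len by (intro eqI[OF q(1)]) auto
    moreover have "b' \<in> univ N" using q(1,3) by (auto simp: H_partial_iso_def)
    ultimately show ?thesis by blast
  qed
  then show ?thesis using eqI[OF p len] by blast
qed

end
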